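(* Let $D$ be a region in the complex plane and let $f_n$ be analytic functions in $D$, where $n$ runs through an infinite sequence of positive integers. Suppose that, as $n\to\infty$ along this sequence, $$\frac1n\log|f_n|\to u\qquad\text{and}\qquad \frac1n\log|f_n'|\to v,$$ where $u$ and $v$ are subharmonic functions in $D$. Then $v\le u$ in $D$, and if $v(z_0)<u(z_0)$ at some point $z_0\in D$, then there is a neighborhood $V$ of $z_0$ such that $u$ is constant on $V$.
   Context: A region is a non-empty connected open set. Convergence of $\frac1n\log|g_n|$ (with $g_n$ analytic in $D$) to a subharmonic function $w$ in $D$ is understood in the sense of Schwartz distributions in $D$ (equivalently, in $L^1_{\mathrm{loc}}(D)$); the limit subharmonic functions are not identically $-\infty$. *)

theory Defs
  imports "HOL-Analysis.Analysis"
begin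

definition region :: "complex set \<Rightarrow> bool" where
  "region D \<longleftrightarrow> D \<noteq> {} \<and> open D \<and> connected D"

definition usc_on :: "'a::topological_space set \<Rightarrow> ('a \<Rightarrow> ereal) \<Rightarrow> bool" where
  "usc_on D u \<longleftrightarrow> (\<forall>z\<in>D. \<forall>c. u z < c \<longrightarrow> (\<forall>\<^sub>F w in at z within D. u w < c))"

(* The mean (1/2\<pi>) \<integral> u(z + r e^(i\<theta>)) d\<theta> as an extended real. Since e2ennreal x is max 0 x, the two
   integrals are those of the positive and the negative part of u on the circle. If u is upper
   semicontinuous and nowhere \<infinity>, the first one is finite, so \<infinity> - \<infinity> does not occur. *)
definition circle_mean :: "(complex \<Rightarrow> ereal) \<Rightarrow> complex \<Rightarrow> real \<Rightarrow> ereal" where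
  "circle_mean u z r =
     (enn2ereal (\<integral>\<^sup>+\<theta>. e2ennreal (u (z + of_real r * cis \<theta>)) \<partial>lebesgue_on {0..2*pi})
      - enn2ereal (\<integral>\<^sup>+\<theta>. e2ennreal (- u (z + of_real r * cis \<theta>)) \<partial>lebesgue_on {0..2*pi}))
     / ereal (2*pi)"

(* The submean inequality is required for all sufficiently small circles around each point; on an
   open set this is equivalent to requiring it for every closed disc contained in the set.
   The function that is identically -\<infinity> is not excluded here. *)
definition subharmonic_on :: "complex set \<Rightarrow> (complex \<Rightarrow> ereal) \<Rightarrow> bool" where
  "subharmonic_on D u \<longleftrightarrow>
     (\<forall>z\<in>D. u z < \<infinity>) \<and> usc_on D u \<and>
     (\<forall>z\<in>D. \<exists>\<rho>>0. cball z \<rho> \<subseteq> D \<and> (\<forall>r. 0 < r \<and> r \<le> \<rho> \<longrightarrow> u z \<le> circle_mean u z r))"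

primrec C_k :: "nat \<Rightarrow> ('a::real_normed_vector \<Rightarrow> 'b::real_normed_vector) \<Rightarrow> bool" where
  "C_k 0 f \<longleftrightarrow> continuous_on UNIV f"
| "C_k (Suc k) f \<longleftrightarrow>
     (\<forall>x. f differentiable at x) \<and> (\<forall>v. C_k k (\<lambda>x. frechet_derivative f (at x) v))"

definition test_function :: "complex set \<Rightarrow> (complex \<Rightarrow> real) \<Rightarrow> bool" where
  "test_function D \<phi> \<longleftrightarrow>
     (\<forall>k. C_k k \<phi>) \<and> compact (closure {z. \<phi> z \<noteq> 0}) \<and> closure {z. \<phi> z \<noteq> 0} \<subseteq> D"

definition locally_integrable_on :: "complex set \<Rightarrow> (complex \<Rightarrow> ereal) \<Rightarrow> bool" where
  "locally_integrable_on D u \<longleftrightarrow>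
     (\<forall>K. compact K \<and> K \<subseteq> D \<longrightarrow>
        u \<in> borel_measurable (lebesgue_on K) \<and>
        (\<integral>\<^sup>+z. e2ennreal \<bar>u z\<bar> \<partial>lebesgue_on K) < \<infinity>)"

(* A locally integrable function is finite almost everywhere, so that the value 0 of
   real_of_ereal at infinite arguments does not affect the integral. *)
definition distr_pairing :: "complex set \<Rightarrow> (complex \<Rightarrow> ereal) \<Rightarrow> (complex \<Rightarrow> real) \<Rightarrow> real" where
  "distr_pairing D u \<phi> = (LINT z|lebesgue_on D. \<phi> z * real_of_ereal (u z))"

(* Local integrability is what makes a function a distribution. It is demanded of the terms only
   eventually, as finitely many of them are irrelevant to convergence; for (1/n) log|g| with
   g analytic in a region it says that g does not vanish identically. *)
definition tendsto_distr ::
    "complex set \<Rightarrow> (nat \<Rightarrow> complex \<Rightarrow> ereal) \<Rightarrow> (complex \<Rightarrow> ereal) \<Rightarrow> nat filter \<Rightarrow> bool" where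
  "tendsto_distr D w u F \<longleftrightarrow>
     (\<forall>\<^sub>F n in F. locally_integrable_on D (w n)) \<and> locally_integrable_on D u \<and>
     (\<forall>\<phi>. test_function D \<phi> \<longrightarrow>
        ((\<lambda>n. distr_pairing D (w n) \<phi>) \<longlongrightarrow> distr_pairing D u \<phi>) F)"

definition log_abs :: "complex \<Rightarrow> ereal" where
  "log_abs z = (if z = 0 then -\<infinity> else ereal (ln (cmod z)))"

end

theory Submission
  imports Defs "HOL-Complex_Analysis.Complex_Analysis"
begin

text \<open>
  Subharmonic functions and the functions \<open>(1/n) log \<bar>f\<^sub>n\<bar>\<close> satisfy the submean inequality against
  smooth radial bumps, hence pointwise values are bounded by the pairings that converge by
  assumption. The uniform boundedness principle, applied to the test functions that are absolutely
  convergent series of translated bumps, bounds \<open>(1/n) log \<bar>f\<^sub>n\<bar>\<close> locally uniformly from above, and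
  this improves to Hartogs' lemma: if \<open>u z\<^sub>0 < c\<close> then \<open>\<bar>f\<^sub>n\<bar> \<le> exp (c n)\<close> near \<open>z\<^sub>0\<close> for large \<open>n\<close>.
  Cauchy's estimate for the derivative then gives \<open>v \<le> u\<close>.

  If \<open>v z\<^sub>0 < c < c' < u z\<^sub>0\<close>, then \<open>\<bar>f\<^sub>n'\<bar> \<le> exp (c n)\<close> on a disc around \<open>z\<^sub>0\<close>, while \<open>\<bar>f\<^sub>n\<bar> > exp (c' n)\<close>
  somewhere on this disc. Hence \<open>f\<^sub>n\<close> is constant there up to a factor close to 1, so all bumps
  supported in the disc see the same limit, and \<open>u\<close> is constant.
\<close>

section \<open>Smooth bump functions\<close>

text \<open>The hypotheses say nothing about single points, whereas the conclusion is pointwise. For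
  the limits, upper semicontinuity and the submean inequality on discs whose size depends on the
  point suffice to recover values from pairings. For (1/n) log |f_n| the admissible radius must not
  depend on n; its submean inequality is therefore proved for every closed disc in \<open>D\<close>,
  wherever the zeros of f_n lie. Zeros on the circles of integration do no harm: inside a disc only
  countably many radii meet zeros, and the passage from circles to radial bumps ignores a null set
  of radii.

  Uniform boundedness is needed only for bumps of one fixed radius with varying centre. A series of
  such translates with absolutely summable coefficients is smooth for arbitrary centres, so a
  gliding hump with explicit coefficients does the work, and no topology on the space of test
  functions enters.\<close>

lemma C_k_imp_continuous_on: "C_k k f \<Longrightarrow> continuous_on UNIV f"
  by (cases k) (auto intro!: continuous_at_imp_continuous_on differentiable_imp_continuous_within)

lemma C_k_SucI:
  assumes "\<And>x. (f has_derivative f' x) (at x)" and "\<And>v. C_k k (\<lambda>x. f' x v)"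
  shows "C_k (Suc k) f"
proof -
  have "frechet_derivative f (at x) = f' x" for x
    using frechet_derivative_at[OF assms(1)] by simp
  then show ?thesis using assms by (auto simp: differentiable_def)
qed

lemma C_k_SucE:
  assumes "C_k (Suc k) f"
  obtains f' where "\<And>x. (f has_derivative f' x) (at x)" and "\<And>v. C_k k (\<lambda>x. f' x v)"
proof (rule that)
  show "(f has_derivative frechet_derivative f (at x)) (at x)" for x
    using assms by (simp add: frechet_derivative_works)
  show "C_k k (\<lambda>x. frechet_derivative f (at x) v)" for v
    using assms by simp
qed

lemma C_k_SucD: "C_k (Suc k) f \<Longrightarrow> C_k k f"
proof (induction k arbitrary: f)
  case 0
  from C_k_imp_continuous_on[OF this] show ?case by simp
next
  case (Suc k)
  then show ?case by (metis C_k.simps(2))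
qed

lemma C_k_const: "C_k k (\<lambda>x. c)"
proof (induction k arbitrary: c)
  case (Suc k)
  show ?case by (rule C_k_SucI[where f' = "\<lambda>_ _. 0"]) (auto intro: Suc)
qed simp

lemma C_k_add: "C_k k f \<Longrightarrow> C_k k g \<Longrightarrow> C_k k (\<lambda>x. f x + g x)"
proof (induction k arbitrary: f g)
  case (Suc k)
  obtain f' where f': "\<And>x. (f has_derivative f' x) (at x)" "\<And>v. C_k k (\<lambda>x. f' x v)"
    using Suc.prems(1) C_k_SucE by blast
  obtain g' where g': "\<And>x. (g has_derivative g' x) (at x)" "\<And>v. C_k k (\<lambda>x. g' x v)"
    using Suc.prems(2) C_k_SucE by blast
  show ?case
    by (rule C_k_SucI[OF has_derivative_add[OF f'(1) g'(1)]]) (intro Suc.IH f' g')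
qed (auto intro: continuous_intros)

lemma C_k_mult:
  fixes f g :: "'a::real_normed_vector \<Rightarrow> 'b::real_normed_algebra"
  shows "C_k k f \<Longrightarrow> C_k k g \<Longrightarrow> C_k k (\<lambda>x. f x * g x)"
proof (induction k arbitrary: f g)
  case (Suc k)
  obtain f' where f': "\<And>x. (f has_derivative f' x) (at x)" "\<And>v. C_k k (\<lambda>x. f' x v)"
    using Suc.prems(1) C_k_SucE by blast
  obtain g' where g': "\<And>x. (g has_derivative g' x) (at x)" "\<And>v. C_k k (\<lambda>x. g' x v)"
    using Suc.prems(2) C_k_SucE by blast
  show ?case
    by (rule C_k_SucI[OF has_derivative_mult[OF f'(1) g'(1)]])
       (intro Suc.IH C_k_add f' g' C_k_SucD[OF Suc.prems(1)] C_k_SucD[OF Suc.prems(2)])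
qed (auto intro: continuous_intros)

lemma C_k_bounded_linear: "bounded_linear f \<Longrightarrow> C_k k f"
  by (cases k)
    (auto intro!: C_k_SucI[where f' = "\<lambda>_. f"] bounded_linear_imp_has_derivative C_k_const
      linear_continuous_on simp del: C_k.simps(2))

text \<open>The induction on \<open>k\<close> treats all indices at once. Differentiating
  \<open>h i (q x)\<close> yields the factor \<open>h' i (q x)\<close>, which need not belong to the
  family; the last assumption only asks it to inherit the smoothness of the members.\<close>

lemma C_k_compose_family:
  fixes h :: "'i \<Rightarrow> real \<Rightarrow> real" and q :: "'a::real_normed_vector \<Rightarrow> real"
  assumes h: "\<And>i t. (h i has_real_derivative h' i t) (at t)"
    and q: "\<And>x. (q has_derivative q' x) (at x)"
    and q': "\<And>k v. C_k k (\<lambda>x. q' x v)"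
    and h': "\<And>k i. (\<And>j. C_k k (\<lambda>x. h j (q x))) \<Longrightarrow> C_k k (\<lambda>x. h' i (q x))"
  shows "C_k k (\<lambda>x. h i (q x))"
proof (induction k arbitrary: i)
  case 0
  have "isCont (\<lambda>x. h i (q x)) x" for x
    by (rule isCont_o2[OF has_derivative_continuous[OF q] DERIV_isCont[OF h]])
  then show ?case by (simp add: continuous_at_imp_continuous_on)
next
  case (Suc k)
  show ?case
  proof (rule C_k_SucI)
    show "((\<lambda>x. h i (q x)) has_derivative (\<lambda>v. q' x v * h' i (q x))) (at x)" for x
      using DERIV_compose_FDERIV[OF h q] .
    show "C_k k (\<lambda>x. q' x v * h' i (q x))" for v
      by (intro C_k_mult q' h' Suc.IH)
  qed
qed

text \<open>The index \<open>a\<close> makes the family closed under differentiation up to linear combinations.\<close>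

definition flat_exp :: "nat \<Rightarrow> real \<Rightarrow> real" where
  "flat_exp a t = (if t \<le> 0 then 0 else exp (- inverse t) * inverse t ^ a)"

lemma flat_exp_nonneg: "0 \<le> flat_exp a t"
  by (simp add: flat_exp_def)

lemma flat_exp_pos: "0 < t \<Longrightarrow> 0 < flat_exp a t"
  by (simp add: flat_exp_def)

lemma exp_ge_power_div_fact:
  fixes x :: real
  assumes "0 \<le> x"
  shows "x ^ n / fact n \<le> exp x"
  using sum_le_suminf[OF summable_exp[of x], of "{n}"] assms
    suminf_cong[of "\<lambda>n. x ^ n /\<^sub>R fact n" "\<lambda>n. inverse (fact n) * x ^ n"]
  by (simp add: exp_def divide_inverse mult.commute)

text \<open>Put x = 1/t in x^(a+2) <= (a+2)! exp x. Two spare powers of t are kept so that the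
  difference quotient at 0 still tends to 0.\<close>

lemma flat_exp_le_square: "flat_exp a t \<le> fact (a + 2) * t\<^sup>2"
proof (cases "t \<le> 0")
  case False
  then have t: "t > 0" by simp
  have "inverse t ^ (a + 2) \<le> fact (a + 2) * exp (inverse t)"
    using t exp_ge_power_div_fact[of "inverse t" "a + 2"] by (simp add: field_simps del: fact_Suc)
  then have "inverse t ^ (a + 2) * (exp (- inverse t) * t\<^sup>2)
      \<le> fact (a + 2) * exp (inverse t) * (exp (- inverse t) * t\<^sup>2)"
    by (rule mult_right_mono) simp
  moreover have "inverse t ^ (a + 2) * (exp (- inverse t) * t\<^sup>2) = flat_exp a t"
    using t by (simp add: flat_exp_def power_add power2_eq_square field_simps)
  moreover have "fact (a + 2) * exp (inverse t) * (exp (- inverse t) * t\<^sup>2) = fact (a + 2) * t\<^sup>2"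
    by (simp add: exp_minus del: fact_Suc)
  ultimately show ?thesis by linarith
qed (simp add: flat_exp_def)

lemma DERIV_flat_exp:
  "(flat_exp a has_real_derivative flat_exp (a + 2) t - real a * flat_exp (a + 1) t) (at t)"
proof (cases t "0::real" rule: linorder_cases)
  case less
  have "((\<lambda>_. 0) has_real_derivative 0) (at t)" by simp
  moreover have "\<forall>\<^sub>F x in nhds t. flat_exp a x = 0"
    using eventually_nhds_in_open[of "{..<0}" t] less
    by (auto simp: flat_exp_def elim!: eventually_mono)
  ultimately show ?thesis using less
    by (subst DERIV_cong_ev[OF refl _ refl, where g = "\<lambda>_. 0"]) (auto simp: flat_exp_def)
next
  case greater
  have inv: "(inverse has_real_derivative - (inverse t)\<^sup>2) (at t)"
    using DERIV_inverse[of t UNIV] greater by (simp add: numeral_2_eq_2)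
  have E: "((\<lambda>t. exp (- inverse t)) has_real_derivative exp (- inverse t) * (inverse t)\<^sup>2) (at t)"
    using DERIV_fun_exp[OF DERIV_minus[OF inv]] by simp
  have P: "((\<lambda>t. inverse t ^ a) has_real_derivative - (real a * inverse t ^ (a + 1))) (at t)"
    using DERIV_power[OF inv, of a]
    by (cases a) (simp_all add: power2_eq_square algebra_simps)
  have "((\<lambda>t. exp (- inverse t) * inverse t ^ a) has_real_derivative
      flat_exp (a + 2) t - real a * flat_exp (a + 1) t) (at t)"
    by (rule DERIV_cong[OF DERIV_mult[OF E P]])
      (use greater in \<open>simp add: flat_exp_def power_add power2_eq_square algebra_simps\<close>)
  moreover have "\<forall>\<^sub>F x in nhds t. flat_exp a x = exp (- inverse x) * inverse x ^ a"
    using eventually_nhds_in_open[of "{0<..}" t] greater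
    by (auto simp: flat_exp_def elim!: eventually_mono)
  ultimately show ?thesis
    by (subst DERIV_cong_ev[OF refl _ refl]) auto
next
  case equal
  have "((\<lambda>y. flat_exp a y / y) \<longlongrightarrow> 0) (at 0)"
  proof (rule Lim_null_comparison)
    show "\<forall>\<^sub>F y in at 0. norm (flat_exp a y / y) \<le> fact (a + 2) * \<bar>y\<bar>"
    proof (rule always_eventually, rule allI)
      fix y
      have "flat_exp a y \<le> fact (a + 2) * \<bar>y\<bar> * \<bar>y\<bar>"
        using flat_exp_le_square[of a y] by (simp add: power2_eq_square mult.assoc abs_mult_self_eq)
      then show "norm (flat_exp a y / y) \<le> fact (a + 2) * \<bar>y\<bar>"
        using flat_exp_nonneg[of a y]
        by (cases "y = 0") (simp_all add: abs_divide pos_divide_le_eq del: fact_Suc)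
    qed
    show "((\<lambda>y::real. fact (a + 2) * \<bar>y\<bar>) \<longlongrightarrow> 0) (at 0)"
      by (auto intro!: tendsto_eq_intros)
  qed
  then show ?thesis using equal by (simp add: DERIV_def flat_exp_def)
qed

text \<open>The standard mollifier, with the squared distance so that it is smooth at the centre. It
  is left unnormalised: normalising would destroy the monotonicity under enlarging the disc
  (\<open>bump_mono\<close>) on which the uniform upper bound rests.\<close>

definition bump :: "real \<Rightarrow> complex \<Rightarrow> complex \<Rightarrow> real" where
  "bump \<rho> z w = flat_exp 0 (\<rho>\<^sup>2 - (norm (w - z))\<^sup>2)"

lemma C_k_bump: "C_k k (bump \<rho> z)"
  unfolding bump_def
proof (rule C_k_compose_family[OF DERIV_flat_exp])
  show "((\<lambda>w. \<rho>\<^sup>2 - (norm (w - z))\<^sup>2) has_derivative (\<lambda>v. (-2) * ((x - z) \<bullet> v))) (at x)" for x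
    unfolding power2_norm_eq_inner
    by (auto intro!: derivative_eq_intros simp: inner_commute)
  show "C_k k (\<lambda>x. (-2) * ((x - z) \<bullet> v))" for k v
    unfolding inner_diff_left right_diff_distrib diff_conv_add_uminus[of "_ * (_ \<bullet> _)"]
    by (intro C_k_add C_k_const C_k_mult C_k_bounded_linear bounded_linear_inner_left)
  show "C_k k (\<lambda>x. flat_exp (i + 2) (\<rho>\<^sup>2 - (cmod (x - z))\<^sup>2) -
          real i * flat_exp (i + 1) (\<rho>\<^sup>2 - (cmod (x - z))\<^sup>2))"
    if "\<And>j. C_k k (\<lambda>x. flat_exp j (\<rho>\<^sup>2 - (cmod (x - z))\<^sup>2))" for k i
    unfolding diff_conv_add_uminus mult_minus_left[symmetric]
    by (intro C_k_add C_k_mult C_k_const that[unfolded diff_conv_add_uminus])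
qed

lemma bump_nonneg: "0 \<le> bump \<rho> z w"
  by (simp add: bump_def flat_exp_nonneg)

lemma bump_le_1: "bump \<rho> z w \<le> 1"
  by (simp add: bump_def flat_exp_def)

lemma bump_pos: "dist z w < \<rho> \<Longrightarrow> 0 < bump \<rho> z w"
  unfolding bump_def
  by (rule flat_exp_pos) (simp add: dist_norm norm_minus_commute power_strict_mono)

lemma bump_eq_0: "0 \<le> \<rho> \<Longrightarrow> w \<notin> ball z \<rho> \<Longrightarrow> bump \<rho> z w = 0"
  by (auto simp: bump_def flat_exp_def dist_norm norm_minus_commute power_mono)

lemma continuous_on_bump: "continuous_on S (bump \<rho> z)"
  using C_k_imp_continuous_on[OF C_k_bump] continuous_on_subset by blast

lemma test_functionI:
  assumes "\<And>k. C_k k \<phi>" "compact K" "K \<subseteq> D" "\<And>z. z \<notin> K \<Longrightarrow> \<phi> z = 0"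
  shows "test_function D \<phi>"
proof -
  have "closure {z. \<phi> z \<noteq> 0} \<subseteq> K"
    using assms by (intro closure_minimal) (auto intro: compact_imp_closed)
  then show ?thesis
    using assms compact_Int_closed[of K "closure {z. \<phi> z \<noteq> 0}"]
    by (auto simp: test_function_def Int_absorb1)
qed

lemma test_function_bump: "0 \<le> \<rho> \<Longrightarrow> cball z \<rho> \<subseteq> D \<Longrightarrow> test_function D (bump \<rho> z)"
  by (rule test_functionI[of _ "cball z \<rho>"]) (auto simp: C_k_bump intro!: bump_eq_0)

text \<open>All translates of a compactly supported function share the same bounds on each
  derivative. Hence summability of the coefficients makes every differentiated series converge
  uniformly, wherever the points \<open>z j\<close> lie. The derivative of \<open>f\<close> in a
  fixed direction again vanishes outside \<open>K\<close>, which drives the induction.\<close>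

lemma C_k_translation_series:
  fixes f :: "complex \<Rightarrow> real"
  assumes "C_k k f" "compact K" "\<And>x. x \<notin> K \<Longrightarrow> f x = 0" and c: "summable (\<lambda>j. \<bar>c j\<bar>)"
  shows "C_k k (\<lambda>x. \<Sum>j. c j * f (x - z j))"
proof -
  have bounded: "\<exists>B\<ge>0. \<forall>x. \<bar>g x\<bar> \<le> B"
    if "continuous_on UNIV g" "\<And>x. x \<notin> K \<Longrightarrow> g x = 0" for g :: "complex \<Rightarrow> real"
  proof -
    have "bounded (g ` K)"
      using assms(2) continuous_on_subset[OF that(1) subset_UNIV]
      by (metis compact_imp_bounded compact_continuous_image)
    then obtain B where B: "B > 0" "\<forall>y\<in>g ` K. norm y \<le> B"
      unfolding bounded_pos by blast
    have "\<bar>g x\<bar> \<le> B" for x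
      using B that(2)[of x] by (cases "x \<in> K") auto
    then show ?thesis using B(1) less_imp_le by blast
  qed
  have dominated: "summable (\<lambda>j. \<bar>c j\<bar> * B)" for B
    using c by (rule summable_mult2)
  show ?thesis using assms(1,3)
  proof (induction k arbitrary: f)
    case 0
    obtain B where B: "B \<ge> 0" "\<And>x. \<bar>f x\<bar> \<le> B" using bounded[of f] 0 by auto
    have "uniform_limit UNIV (\<lambda>n x. \<Sum>i<n. c i * f (x - z i)) (\<lambda>x. \<Sum>i. c i * f (x - z i)) sequentially"
      by (rule Weierstrass_m_test[OF _ dominated[of B]])
        (use B in \<open>auto simp: abs_mult intro: mult_left_mono\<close>)
    then have "continuous_on UNIV (\<lambda>x. \<Sum>i. c i * f (x - z i))"
    proof (rule uniform_limit_theorem[rotated])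
      show "\<forall>\<^sub>F n in sequentially. continuous_on UNIV (\<lambda>x. \<Sum>i<n. c i * f (x - z i))"
        using 0(1) by (auto intro!: always_eventually continuous_intros continuous_on_compose2[of UNIV f])
    qed simp
    then show ?case by simp
  next
    case (Suc k)
    obtain f' where f': "\<And>x. (f has_derivative f' x) (at x)" "\<And>v. C_k k (\<lambda>x. f' x v)"
      using Suc.prems(1) C_k_SucE by blast
    have f'_zero: "f' x v = 0" if "x \<notin> K" for x v
    proof -
      have "open (- K)" using assms(2) by (simp add: compact_imp_closed open_Compl)
      then have "(f has_derivative (\<lambda>_. 0)) (at x)"
        using that Suc.prems(2)
        by (intro has_derivative_transform_within_open[of "\<lambda>_. 0" "\<lambda>_. 0" x UNIV "- K" f]) auto
      then show ?thesis using f'(1) has_derivative_unique by metis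
    qed
    \<comment> \<open>Differentiating the series needs an error bound proportional to
      \<open>norm v\<close>. Bounding the directional derivatives along the basis 1, i bounds the
      linear maps \<open>f' x\<close> uniformly.\<close>
    obtain B1 where B1: "B1 \<ge> 0" "\<And>x. \<bar>f' x 1\<bar> \<le> B1"
      using bounded[of "\<lambda>x. f' x 1"] f'(2) f'_zero C_k_imp_continuous_on by blast
    obtain B2 where B2: "B2 \<ge> 0" "\<And>x. \<bar>f' x \<i>\<bar> \<le> B2"
      using bounded[of "\<lambda>x. f' x \<i>"] f'(2) f'_zero C_k_imp_continuous_on by blast
    have lin: "linear (f' x)" for x using f'(1) has_derivative_linear by blast
    have f'_bound: "\<bar>f' x v\<bar> \<le> (B1 + B2) * norm v" for x v
    proof -
      have "v = Re v *\<^sub>R 1 + Im v *\<^sub>R \<i>"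
        by (simp add: complex_eq_iff)
      then have "f' x v = Re v * f' x 1 + Im v * f' x \<i>"
        using linear_add[OF lin] linear_scale[OF lin] by (metis real_scaleR_def)
      also have "\<bar>\<dots>\<bar> \<le> \<bar>Re v\<bar> * \<bar>f' x 1\<bar> + \<bar>Im v\<bar> * \<bar>f' x \<i>\<bar>"
        by (metis abs_mult abs_triangle_ineq)
      also have "\<dots> \<le> norm v * B1 + norm v * B2"
        by (intro add_mono mult_mono abs_Re_le_cmod abs_Im_le_cmod B1 B2) auto
      finally show ?thesis by (simp add: algebra_simps)
    qed
    obtain B where B: "B \<ge> 0" "\<And>x. \<bar>f x\<bar> \<le> B"
      using bounded[of f] Suc.prems C_k_imp_continuous_on by blast
    have sums: "summable (\<lambda>j. c j * f (x - z j))" for x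
      by (rule summable_comparison_test'[OF dominated[of B]])
        (use B in \<open>auto simp: abs_mult intro: mult_left_mono\<close>)
    have sums': "summable (\<lambda>j. \<bar>c j * f' (x - z j) v\<bar>)" for x v
      by (rule summable_comparison_test'[OF dominated[of "(B1 + B2) * norm v"]])
        (use f'_bound in \<open>auto simp: abs_mult intro: mult_left_mono\<close>)
    define g' where "g' x v = (\<Sum>j. c j * f' (x - z j) v)" for x v
    have "\<exists>g. \<forall>x\<in>UNIV. (\<lambda>j. c j * f (x - z j)) sums g x \<and> (g has_derivative g' x) (at x within UNIV)"
    proof (rule has_derivative_series)
      show "((\<lambda>x. c n * f (x - z n)) has_derivative (\<lambda>v. c n * f' (x - z n) v)) (at x within UNIV)" for n x
        by (intro has_derivative_mult_right has_derivative_compose[OF _ f'(1)])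
          (auto intro!: derivative_eq_intros)
      show "\<forall>\<^sub>F n in sequentially. \<forall>x\<in>UNIV. \<forall>v. norm ((\<Sum>i<n. c i * f' (x - z i) v) - g' x v) \<le> e * norm v"
        if "e > 0" for e
      proof -
        have "(\<lambda>n. \<Sum>i. \<bar>c (i + n)\<bar> * (B1 + B2)) \<longlonglongrightarrow> 0"
          using suminf_exist_split2[OF dominated[of "B1 + B2"]] .
        then have "\<forall>\<^sub>F n in sequentially. (\<Sum>i. \<bar>c (i + n)\<bar> * (B1 + B2)) < e"
          using that by (rule order_tendstoD)
        then show ?thesis
        proof eventually_elim
          case (elim n)
          show ?case
          proof (intro ballI allI)
            fix x v :: complex
            let ?t = "\<lambda>i. c (i + n) * f' (x - z (i + n)) v"
            have tail: "summable (\<lambda>i. \<bar>c (i + n)\<bar> * (B1 + B2))"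
              using dominated[of "B1 + B2"] by (subst summable_iff_shift)
            have "g' x v = (\<Sum>i. ?t i) + (\<Sum>i<n. c i * f' (x - z i) v)"
              unfolding g'_def by (rule suminf_split_initial_segment[OF summable_rabs_cancel[OF sums']])
            then have "norm ((\<Sum>i<n. c i * f' (x - z i) v) - g' x v) = \<bar>\<Sum>i. ?t i\<bar>" by simp
            also have "\<dots> \<le> (\<Sum>i. \<bar>?t i\<bar>)"
              using sums' by (intro summable_rabs) (subst summable_iff_shift[of "\<lambda>i. \<bar>c i * f' (x - z i) v\<bar>"])
            also have "\<dots> \<le> (\<Sum>i. \<bar>c (i + n)\<bar> * (B1 + B2) * norm v)"
            proof (rule suminf_le)
              show "\<bar>?t i\<bar> \<le> \<bar>c (i + n)\<bar> * (B1 + B2) * norm v" for i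
                using f'_bound[of "x - z (i + n)" v]
                by (auto simp: abs_mult mult.assoc intro: mult_left_mono)
              show "summable (\<lambda>i. \<bar>?t i\<bar>)"
                using sums' by (subst summable_iff_shift[of "\<lambda>i. \<bar>c i * f' (x - z i) v\<bar>"])
              show "summable (\<lambda>i. \<bar>c (i + n)\<bar> * (B1 + B2) * norm v)"
                using tail by (rule summable_mult2)
            qed
            also have "\<dots> = (\<Sum>i. \<bar>c (i + n)\<bar> * (B1 + B2)) * norm v"
              using tail by (rule suminf_mult2[symmetric])
            also have "\<dots> \<le> e * norm v" using elim by (intro mult_right_mono) auto
            finally show "norm ((\<Sum>i<n. c i * f' (x - z i) v) - g' x v) \<le> e * norm v" .
          qed
        qed
      qed
      show "(\<lambda>j. c j * f (0 - z j)) sums (\<Sum>j. c j * f (0 - z j))"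
        using sums by (rule summable_sums)
    qed auto
    then obtain g where g: "\<And>x. (\<lambda>j. c j * f (x - z j)) sums g x"
      "\<And>x. (g has_derivative g' x) (at x)" by auto
    have "g = (\<lambda>x. \<Sum>j. c j * f (x - z j))" using g(1) sums_unique by auto
    moreover have "C_k (Suc k) g"
      by (rule C_k_SucI[OF g(2)]) (unfold g'_def, rule Suc.IH[OF f'(2) f'_zero])
    ultimately show ?case by simp
  qed
qed

section \<open>Radial kernels\<close>

lemma borel_measurable_Complex [measurable]:
  "(\<lambda>p. Complex (fst p) (snd p)) \<in> borel \<Otimes>\<^sub>M borel \<rightarrow>\<^sub>M borel"
  unfolding borel_prod
  by (rule borel_measurable_continuous_onI) (simp add: Complex_eq continuous_intros)

text \<open>Needed for Fubini in real and imaginary part: \<open>lborel\<close> on the complex plane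
  is not a product measure by definition. Comparing the two measures on boxes is enough.\<close>

lemma lborel_complex:
  "(lborel :: complex measure) = distr (lborel \<Otimes>\<^sub>M lborel) borel (\<lambda>p. Complex (fst p) (snd p))"
proof (rule lborel_eqI)
  fix l u :: complex
  assume le: "\<And>b. b \<in> Basis \<Longrightarrow> l \<bullet> b \<le> u \<bullet> b"
  have eq: "(\<lambda>p. Complex (fst p) (snd p)) -` box l u
      = box (Re l) (Re u) \<times> box (Im l) (Im u)"
    by (auto simp: box_def Basis_complex_def)
  show "emeasure (distr (lborel \<Otimes>\<^sub>M lborel) borel (\<lambda>p. Complex (fst p) (snd p))) (box l u)
      = (\<Prod>b\<in>Basis. (u - l) \<bullet> b)"
    using le[of 1] le[of \<i>]
    by (subst emeasure_distr)
      (auto simp: space_pair_measure eq lborel.emeasure_pair_measure_Times Basis_complex_def ennreal_mult)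
qed simp

lemma nn_integral_lborel_complex:
  fixes g :: "complex \<Rightarrow> ennreal"
  assumes [measurable]: "g \<in> borel_measurable borel"
  shows "(\<integral>\<^sup>+z. g z \<partial>lborel) = (\<integral>\<^sup>+x. \<integral>\<^sup>+y. g (Complex x y) \<partial>lborel \<partial>lborel)"
    and "(\<integral>\<^sup>+z. g z \<partial>lborel) = (\<integral>\<^sup>+y. \<integral>\<^sup>+x. g (Complex x y) \<partial>lborel \<partial>lborel)"
proof -
  have "(\<integral>\<^sup>+z. g z \<partial>lborel) = (\<integral>\<^sup>+p. g (Complex (fst p) (snd p)) \<partial>(lborel \<Otimes>\<^sub>M lborel))"
    by (subst lborel_complex, subst nn_integral_distr) simp_all
  also have "\<dots> = (\<integral>\<^sup>+x. \<integral>\<^sup>+y. g (Complex x y) \<partial>lborel \<partial>lborel)"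
    by (subst lborel.nn_integral_fst[symmetric]) simp_all
  finally show 1: "(\<integral>\<^sup>+z. g z \<partial>lborel) = (\<integral>\<^sup>+x. \<integral>\<^sup>+y. g (Complex x y) \<partial>lborel \<partial>lborel)" .
  have "(\<lambda>(x, y). g (Complex x y)) \<in> borel_measurable (lborel \<Otimes>\<^sub>M lborel)"
    using measurable_compose[OF borel_measurable_Complex assms] by (simp add: case_prod_beta')
  then show "(\<integral>\<^sup>+z. g z \<partial>lborel) = (\<integral>\<^sup>+y. \<integral>\<^sup>+x. g (Complex x y) \<partial>lborel \<partial>lborel)"
    unfolding 1 by (rule lborel_pair.Fubini'[symmetric])
qed

text \<open>With the sheared coordinate as the inner variable of Fubini, a shear is a translation of
  that variable.\<close>

lemma nn_integral_lborel_shear: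
  fixes g :: "complex \<Rightarrow> ennreal" and a :: real
  assumes [measurable]: "g \<in> borel_measurable borel"
  shows nn_integral_lborel_shear_Re:
      "(\<integral>\<^sup>+z. g (Complex (Re z + a * Im z) (Im z)) \<partial>lborel) = (\<integral>\<^sup>+z. g z \<partial>lborel)"
    and nn_integral_lborel_shear_Im:
      "(\<integral>\<^sup>+z. g (Complex (Re z) (Im z + a * Re z)) \<partial>lborel) = (\<integral>\<^sup>+z. g z \<partial>lborel)"
proof -
  have [measurable]: "(\<lambda>z. Complex (p z) (q z)) \<in> borel \<rightarrow>\<^sub>M borel"
    if "p \<in> borel_measurable borel" "q \<in> borel_measurable borel" for p q :: "'c::topological_space \<Rightarrow> real"
    using that measurable_compose[OF measurable_Pair[OF that] borel_measurable_Complex] by simp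
  show "(\<integral>\<^sup>+z. g (Complex (Re z + a * Im z) (Im z)) \<partial>lborel) = (\<integral>\<^sup>+z. g z \<partial>lborel)"
    using nn_integral_real_affine[of "\<lambda>x. g (Complex x y)" 1 "a * y" for y]
    by (subst (1 2) nn_integral_lborel_complex(2)) (simp_all add: add.commute)
  show "(\<integral>\<^sup>+z. g (Complex (Re z) (Im z + a * Re z)) \<partial>lborel) = (\<integral>\<^sup>+z. g z \<partial>lborel)"
    using nn_integral_real_affine[of "\<lambda>y. g (Complex x y)" 1 "a * x" for x]
    by (subst (1 2) nn_integral_lborel_complex(1)) (simp_all add: add.commute)
qed

text \<open>A rotation is a product of three shears.\<close>

lemma nn_integral_lborel_rotate:
  fixes g :: "complex \<Rightarrow> ennreal"
  assumes [measurable]: "g \<in> borel_measurable borel" and w: "norm w = 1"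
  shows "(\<integral>\<^sup>+z. g (w * z) \<partial>lborel) = (\<integral>\<^sup>+z. g z \<partial>lborel)"
proof -
  have shears: "(\<integral>\<^sup>+z. g (w * z) \<partial>lborel) = (\<integral>\<^sup>+z. g z \<partial>lborel)"
    if [measurable]: "g \<in> borel_measurable borel" and "Im w \<noteq> 0" "norm w = 1" for g :: "complex \<Rightarrow> ennreal" and w
  proof -
    \<comment> \<open>For \<open>w = cis \<theta>\<close> this is tan (\<theta>/2); the two outer
      shears have coefficient -t and the middle one has coefficient sin \<theta>.\<close>
    define t where "t = (1 - Re w) / Im w"
    have norm: "(Re w)\<^sup>2 + (Im w)\<^sup>2 = 1" using that(3) by (simp add: cmod_def)
    have st: "Im w * t = 1 - Re w" using that(2) by (simp add: t_def)
    have "Im w * (t * (1 + Re w)) = (1 - Re w) * (1 + Re w)"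
      using st by (metis mult.assoc)
    also have "\<dots> = Im w * Im w"
      using norm by (simp add: power2_eq_square algebra_simps)
    finally have "Im w * (t * (1 + Re w)) = Im w * Im w" .
    then have tc: "t * (1 + Re w) = Im w" using that(2) by simp
    define S where "S z = Complex (Re z + (- t) * Im z) (Im z)" for z
    define S' where "S' z = Complex (Re z) (Im z + Im w * Re z)" for z
    have [measurable]: "S \<in> borel \<rightarrow>\<^sub>M borel" "S' \<in> borel \<rightarrow>\<^sub>M borel"
      unfolding S_def S'_def Complex_eq
      by (intro borel_measurable_continuous_onI continuous_intros)+
    have "w * z = S (S' (S z))" for z
    proof (rule complex_eqI)
      have "Im (S (S' (S z))) = Im w * Re z + (1 - Im w * t) * Im z"
        by (simp add: S_def S'_def algebra_simps)
      then show I: "Im (w * z) = Im (S (S' (S z)))" using st by simp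
      have "Re (S (S' (S z))) = Re z - t * Im z - t * Im (S (S' (S z)))"
        by (simp add: S_def S'_def)
      also have "\<dots> = Re z - t * Im z - t * (Im w * Re z + Re w * Im z)"
        unfolding I[symmetric] by (simp add: algebra_simps)
      also have "\<dots> = (1 - Im w * t) * Re z - t * (1 + Re w) * Im z"
        by (simp add: algebra_simps)
      finally show "Re (w * z) = Re (S (S' (S z)))" using st tc by simp
    qed
    then have "(\<integral>\<^sup>+z. g (w * z) \<partial>lborel) = (\<integral>\<^sup>+z. g (S (S' (S z))) \<partial>lborel)" by simp
    also have "\<dots> = (\<integral>\<^sup>+z. g (S (S' z)) \<partial>lborel)"
      using nn_integral_lborel_shear_Re[of "\<lambda>z. g (S (S' z))" "- t"] unfolding S_def[symmetric] by simp
    also have "\<dots> = (\<integral>\<^sup>+z. g (S z) \<partial>lborel)"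
      using nn_integral_lborel_shear_Im[of "\<lambda>z. g (S z)" "Im w"] unfolding S'_def[symmetric] by simp
    also have "\<dots> = (\<integral>\<^sup>+z. g z \<partial>lborel)"
      using nn_integral_lborel_shear_Re[of "\<lambda>z. g z" "- t"] unfolding S_def[symmetric] by simp
    finally show ?thesis .
  qed
  show ?thesis
  proof (cases "Im w = 0")
    case True
    then have "\<bar>Re w\<bar> = 1" using w by (simp add: cmod_eq_Re)
    \<comment> \<open>The half turn has no such factorisation, since t would be infinite; it is
      performed as two quarter turns.\<close>
    then have "w = 1 \<or> w = \<i> * \<i>" using True by (auto simp: complex_eq_iff abs_if split: if_splits)
    then show ?thesis
    proof
      assume "w = \<i> * \<i>"
      then show ?thesis
        using shears[of "\<lambda>z. g (\<i> * z)" \<i>] shears[of g \<i>] by (simp add: mult.assoc)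
    qed simp
  qed (use shears w in simp)
qed

section \<open>Circle integrals and radial kernels\<close>

lemma nn_integral_periodic_shift:
  fixes h :: "real \<Rightarrow> ennreal"
  assumes [measurable]: "h \<in> borel_measurable borel" and per: "\<And>t. h (p + t) = h t"
    and a: "0 \<le> a" "a \<le> p"
  shows "(\<integral>\<^sup>+t. h (a + t) * indicator {0..<p} t \<partial>lborel) = (\<integral>\<^sup>+t. h t * indicator {0..<p} t \<partial>lborel)"
proof -
  have "(\<integral>\<^sup>+t. h (a + t) * indicator {0..<p} t \<partial>lborel) = (\<integral>\<^sup>+t. h t * indicator {a..<a + p} t \<partial>lborel)"
    by (subst nn_integral_real_affine[of "\<lambda>t. h t * indicator {a..<a + p} t" 1 a])
      (auto intro!: nn_integral_cong split: split_indicator)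
  also have "\<dots> = (\<integral>\<^sup>+t. h t * indicator {a..<p} t + h t * indicator {p..<p + a} t \<partial>lborel)"
    using a by (intro nn_integral_cong) (auto split: split_indicator)
  also have "\<dots> = (\<integral>\<^sup>+t. h t * indicator {a..<p} t \<partial>lborel) + (\<integral>\<^sup>+t. h t * indicator {p..<p + a} t \<partial>lborel)"
    by (rule nn_integral_add) simp_all
  also have "(\<integral>\<^sup>+t. h t * indicator {p..<p + a} t \<partial>lborel) = (\<integral>\<^sup>+t. h t * indicator {0..<a} t \<partial>lborel)"
    by (subst nn_integral_real_affine[of "\<lambda>t. h t * indicator {p..<p + a} t" 1 p])
      (auto simp: per intro!: nn_integral_cong split: split_indicator)
  also have "(\<integral>\<^sup>+t. h t * indicator {a..<p} t \<partial>lborel) + (\<integral>\<^sup>+t. h t * indicator {0..<a} t \<partial>lborel)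
      = (\<integral>\<^sup>+t. h t * indicator {a..<p} t + h t * indicator {0..<a} t \<partial>lborel)"
    by (rule nn_integral_add[symmetric]) simp_all
  also have "\<dots> = (\<integral>\<^sup>+t. h t * indicator {0..<p} t \<partial>lborel)"
    using a by (intro nn_integral_cong) (auto split: split_indicator)
  finally show ?thesis .
qed

text \<open>\<open>circle_mean\<close> is an integral over a closed interval for the completed
  measure, while shifting a period requires half-open pieces that fit together; the endpoint is a
  null set.\<close>

lemma nn_integral_lebesgue_on_Icc:
  fixes h :: "real \<Rightarrow> ennreal"
  shows "(\<integral>\<^sup>+t. h t \<partial>lebesgue_on {a..b}) = (\<integral>\<^sup>+t. h t * indicator {a..<b} t \<partial>lborel)"
proof -
  have "(\<integral>\<^sup>+t. h t \<partial>lebesgue_on {a..b}) = (\<integral>\<^sup>+t. h t * indicator {a..b} t \<partial>lborel)"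
    by (subst nn_integral_restrict_space) (auto simp: nn_integral_completion)
  also have "\<dots> = (\<integral>\<^sup>+t. h t * indicator {a..<b} t \<partial>lborel)"
  proof (rule nn_integral_cong_AE)
    have "AE t in lborel. t \<noteq> b" by (rule AE_lborel_singleton)
    then show "AE t in lborel. h t * indicator {a..b} t = h t * indicator {a..<b} t"
      by eventually_elim (auto split: split_indicator)
  qed
  finally show ?thesis .
qed

text \<open>The rotated points \<open>cis t * w\<close> run through the circle of radius
  \<open>norm w\<close> starting at the argument of \<open>w\<close>; by periodicity the starting
  angle is irrelevant.\<close>

lemma nn_integral_circle_rotate:
  fixes G :: "complex \<Rightarrow> ennreal"
  assumes [measurable]: "G \<in> borel_measurable borel"
  shows "(\<integral>\<^sup>+t. G (z + cis t * w) * indicator {0..<2 * pi} t \<partial>lborel)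
    = (\<integral>\<^sup>+t. G (z + of_real (norm w) * cis t) \<partial>lebesgue_on {0..2 * pi})"
proof -
  have [measurable]: "cis \<in> borel \<rightarrow>\<^sub>M borel"
    by (intro borel_measurable_continuous_onI continuous_intros)
  define h where "h t = G (z + of_real (norm w) * cis t)" for t
  have [measurable]: "h \<in> borel_measurable borel" unfolding h_def by measurable
  have "w = of_real (norm w) * cis (Arg2pi w)"
    using Arg2pi_eq[of w] by (simp add: cis_conv_exp)
  then have "z + cis t * w = z + of_real (norm w) * cis (Arg2pi w + t)" for t
    by (metis (no_types, lifting) cis_mult mult.assoc mult.commute)
  then have "(\<integral>\<^sup>+t. G (z + cis t * w) * indicator {0..<2 * pi} t \<partial>lborel)
      = (\<integral>\<^sup>+t. h (Arg2pi w + t) * indicator {0..<2 * pi} t \<partial>lborel)"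
    by (simp add: h_def)
  also have "\<dots> = (\<integral>\<^sup>+t. h t * indicator {0..<2 * pi} t \<partial>lborel)"
    using Arg2pi[of w] by (intro nn_integral_periodic_shift) (auto simp: h_def cis_mult[symmetric])
  finally show ?thesis by (simp add: h_def nn_integral_lebesgue_on_Icc)
qed

text \<open>Averaging over rotations of the kernel takes the place of polar coordinates.\<close>

lemma nn_integral_radial_kernel_le:
  fixes G k :: "complex \<Rightarrow> ennreal"
  assumes [measurable]: "G \<in> borel_measurable borel" "k \<in> borel_measurable borel"
    and radial: "\<And>w w'. norm w = norm w' \<Longrightarrow> k w = k w'"
    and circles: "AE w in lborel. k w \<noteq> 0 \<longrightarrow>
      (\<integral>\<^sup>+t. G (z + of_real (norm w) * cis t) \<partial>lebesgue_on {0..2 * pi}) \<le> ennreal (2 * pi) * C"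
  shows "(\<integral>\<^sup>+w. k (w - z) * G w \<partial>lborel) \<le> C * (\<integral>\<^sup>+w. k w \<partial>lborel)"
proof -
  have [measurable]: "cis \<in> borel \<rightarrow>\<^sub>M borel"
    by (intro borel_measurable_continuous_onI continuous_intros)
  let ?I = "indicator {0..<2 * pi} :: real \<Rightarrow> ennreal"
  have shift: "(\<integral>\<^sup>+w. k (w - z) * G w \<partial>lborel) = (\<integral>\<^sup>+w. k w * G (z + w) \<partial>lborel)"
    by (subst lborel_distr_plus[of z, symmetric], subst nn_integral_distr) simp_all
  \<comment> \<open>The factor 2 pi is spread out as an integral over the angle t, and the inner
    integral is rotated by \<open>cis t\<close> for each t separately, which the radial
    \<open>k\<close> does not notice. After Fubini the integral over t runs around the circle of
    radius \<open>norm w\<close>.\<close>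
  have "emeasure lborel {0..<2 * pi} = ennreal (2 * pi)"
    by simp
  then have "ennreal (2 * pi) * (\<integral>\<^sup>+w. k w * G (z + w) \<partial>lborel)
      = (\<integral>\<^sup>+t. (\<integral>\<^sup>+w. k w * G (z + w) \<partial>lborel) * ?I t \<partial>lborel)"
    by (subst nn_integral_cmult) (simp_all add: mult.commute)
  also have "\<dots> = (\<integral>\<^sup>+t. (\<integral>\<^sup>+w. k w * G (z + cis t * w) \<partial>lborel) * ?I t \<partial>lborel)"
  proof (rule nn_integral_cong)
    fix t
    have "(\<integral>\<^sup>+w. k w * G (z + w) \<partial>lborel) = (\<integral>\<^sup>+w. k (cis t * w) * G (z + cis t * w) \<partial>lborel)"
      by (rule nn_integral_lborel_rotate[symmetric]) simp_all
    also have "\<dots> = (\<integral>\<^sup>+w. k w * G (z + cis t * w) \<partial>lborel)"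
      by (intro nn_integral_cong arg_cong2[where f = "(*)"] refl radial) (simp add: norm_mult)
    finally show "(\<integral>\<^sup>+w. k w * G (z + w) \<partial>lborel) * ?I t = (\<integral>\<^sup>+w. k w * G (z + cis t * w) \<partial>lborel) * ?I t"
      by (rule arg_cong)
  qed
  also have "\<dots> = (\<integral>\<^sup>+t. \<integral>\<^sup>+w. k w * G (z + cis t * w) * ?I t \<partial>lborel \<partial>lborel)"
    by (subst nn_integral_multc) simp_all
  also have "\<dots> = (\<integral>\<^sup>+w. \<integral>\<^sup>+t. k w * G (z + cis t * w) * ?I t \<partial>lborel \<partial>lborel)"
    by (rule lborel_pair.Fubini'[symmetric]) simp
  also have "\<dots> = (\<integral>\<^sup>+w. k w * (\<integral>\<^sup>+t. G (z + of_real (norm w) * cis t) \<partial>lebesgue_on {0..2 * pi}) \<partial>lborel)"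
    by (simp add: nn_integral_circle_rotate[symmetric] mult.assoc nn_integral_cmult)
  also have "\<dots> \<le> (\<integral>\<^sup>+w. k w * (ennreal (2 * pi) * C) \<partial>lborel)"
    using circles by (intro nn_integral_mono_AE) (auto intro: mult_left_mono elim!: eventually_mono)
  also have "\<dots> = ennreal (2 * pi) * (C * (\<integral>\<^sup>+w. k w \<partial>lborel))"
    by (subst nn_integral_multc) (simp_all add: mult_ac)
  finally show ?thesis
    unfolding shift by (subst (asm) ennreal_mult_le_mult_iff) (simp_all add: ennreal_eq_0_iff not_le)
qed

section \<open>The submean inequality for the logarithm of a holomorphic function\<close>

text \<open>On the disc f = exp g, so ln |f| = Re g, and Cauchy's formula gives g its mean value
  property: on the circle the kernel du/u becomes i dt. Taking imaginary parts of i g yields Re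
  g.\<close>

lemma has_integral_ln_cmod_circle_nonvanishing:
  assumes f: "f holomorphic_on ball 0 R" and r: "0 < r" "r < R"
    and nz: "\<And>w. w \<in> ball 0 R \<Longrightarrow> f w \<noteq> 0"
  shows "((\<lambda>t. ln (cmod (f (of_real r * cis t)))) has_integral 2 * pi * ln (cmod (f 0))) {0..2 * pi}"
proof -
  obtain g where g: "g holomorphic_on ball 0 R" "\<And>w. w \<in> ball 0 R \<Longrightarrow> f w = exp (g w)"
    using contractible_imp_holomorphic_log[OF f convex_imp_contractible[OF convex_ball] nz] by blast
  have "((\<lambda>u. g u / (u - 0)) has_contour_integral 2 * of_real pi * \<i> * g 0) (circlepath 0 r)"
  proof (rule Cauchy_integral_circlepath)
    show "continuous_on (cball 0 r) g"
      using r by (intro continuous_on_subset[OF holomorphic_on_imp_continuous_on[OF g(1)]]) auto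
    show "g holomorphic_on ball 0 r"
      using r by (intro holomorphic_on_subset[OF g(1)]) auto
  qed (use r in auto)
  then have "((\<lambda>t. g (of_real r * cis t) / (of_real r * cis t) * of_real r * \<i> * cis t)
      has_integral 2 * of_real pi * \<i> * g 0) {0..2 * pi}"
    unfolding circlepath_def by (subst (asm) has_contour_integral_part_circlepath_iff) auto
  moreover have "g (of_real r * cis t) / (of_real r * cis t) * of_real r * \<i> * cis t
      = \<i> * g (of_real r * cis t)" for t
    using r by simp
  ultimately have "((\<lambda>t. \<i> * g (of_real r * cis t)) has_integral 2 * of_real pi * \<i> * g 0) {0..2 * pi}"
    by (simp only:)
  from has_integral_linear[OF this bounded_linear_Im]
  have "((\<lambda>t. Re (g (of_real r * cis t))) has_integral 2 * pi * Re (g 0)) {0..2 * pi}"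
    by (simp add: o_def)
  moreover have "ln (cmod (f w)) = Re (g w)" if "w \<in> ball 0 R" for w
    using g(2)[OF that] by simp
  ultimately show ?thesis
    using r by (simp add: norm_mult)
qed

text \<open>A zero of \<open>f\<close> inside the circle is removed by a Blaschke factor; this keeps \<open>\<bar>f\<bar>\<close> on the
  circle but multiplies \<open>\<bar>f 0\<bar>\<close> by at least \<open>r / s > 1\<close>, so by the maximum principle the process
  stops after finitely many steps.\<close>

lemma ln_cmod_le_circle_mean_aux:
  assumes r: "0 < s" "s < r" "r < R" "R * s \<le> r\<^sup>2"
    and "f holomorphic_on ball 0 R"
    and "\<And>w. w \<in> ball 0 R \<Longrightarrow> f w = 0 \<Longrightarrow> cmod w \<le> s"
    and "f 0 \<noteq> 0" and "\<And>w. cmod w = r \<Longrightarrow> cmod (f w) \<le> M" and "M < cmod (f 0) * (r / s) ^ k"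
  shows "2 * pi * ln (cmod (f 0)) \<le> integral {0..2 * pi} (\<lambda>t. ln (cmod (f (of_real r * cis t))))"
  using assms(5-)
proof (induction k arbitrary: f)
  case 0
  \<comment> \<open>Cauchy's inequality of order 0 is the maximum principle |f 0| <=
    \<open>M\<close>, which contradicts the last premise.\<close>
  have "cmod ((deriv ^^ 0) f 0) \<le> fact 0 * M / r ^ 0"
  proof (rule Cauchy_inequality)
    show "continuous_on (cball 0 r) f"
      using r by (intro continuous_on_subset[OF holomorphic_on_imp_continuous_on[OF 0(1)]]) auto
    show "f holomorphic_on ball 0 r"
      using r by (intro holomorphic_on_subset[OF 0(1)]) auto
  qed (use r 0 in auto)
  then show ?case using 0 by simp
next
  case (Suc k)
  show ?case
  proof (cases "\<exists>a\<in>ball 0 R. f a = 0")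
    case False
    then show ?thesis
      using has_integral_ln_cmod_circle_nonvanishing[OF Suc.prems(1), of r] r
      by (auto dest!: integral_unique)
  next
    case True
    then obtain a where a: "a \<in> ball 0 R" "f a = 0" "cmod a \<le> s" "a \<noteq> 0"
      using Suc.prems(2,3) by metis
    define F where "F w = (if w = a then deriv f a else (f w - f a) / (w - a))" for w
    \<comment> \<open>The factor (r^2 - conj(a) w) / (r (w - a)) has modulus 1 on |w| = r; its pole
      at a is cancelled by the zero of f, so it is split between \<open>F\<close> and
      \<open>g\<close>.\<close>
    define g where "g w = F w * ((of_real (r\<^sup>2) - cnj a * w) / of_real r)" for w
    have hol: "g holomorphic_on ball 0 R"
      unfolding g_def F_def using r
      by (intro holomorphic_intros pole_lemma_open Suc.prems(1)) auto
    \<comment> \<open>The new factor vanishes only at r^2 / conj(a), whose modulus is at least r^2 /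
      s and hence at least R. This is the purpose of \<open>R * s \<le> r\<^sup>2\<close>: no zero
      enters the disc.\<close>
    have zeros: "cmod w \<le> s" if w: "w \<in> ball 0 R" "g w = 0" for w
    proof (rule ccontr)
      assume "\<not> cmod w \<le> s"
      then have "F w \<noteq> 0" using a Suc.prems(2)[OF w(1)] by (auto simp: F_def)
      then have "cnj a * w = of_real (r\<^sup>2)" using w(2) r by (simp add: g_def)
      then have "cmod a * cmod w = r\<^sup>2"
        using norm_mult[of "cnj a" w] by (simp add: norm_power)
      moreover have "cmod a * cmod w < s * R"
        using a w(1) r by (intro mult_le_less_imp_less) auto
      ultimately show False using r(4) by (simp add: mult.commute)
    qed
    have circle: "cmod (g w) = cmod (f w)" if w: "cmod w = r" for w
    proof -
      have "w \<noteq> a" using w a(3) r by auto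
      have "of_real (r\<^sup>2) = w * cnj w"
        using complex_norm_square[of w] w by simp
      then have "of_real (r\<^sup>2) - cnj a * w = w * cnj (w - a)"
        by (simp add: algebra_simps)
      then have "cmod (of_real (r\<^sup>2) - cnj a * w) = r * cmod (w - a)"
        using w by (metis complex_mod_cnj norm_mult)
      then show ?thesis
        using \<open>w \<noteq> a\<close> r a(2) by (simp add: g_def F_def norm_mult norm_divide)
    qed
    have g0: "cmod (g 0) = cmod (f 0) * (r / cmod a)"
      using a r by (simp add: g_def F_def norm_mult norm_divide norm_power power2_eq_square)
    have "r / s \<le> r / cmod a" using a r by (intro divide_left_mono) auto
    then have g0_ge: "cmod (f 0) * (r / s) \<le> cmod (g 0)"
      unfolding g0 by (intro mult_left_mono) auto
    have "cmod (f 0) * 1 \<le> cmod (f 0) * (r / s)"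
      using r by (intro mult_left_mono) auto
    with g0_ge have g0_ge': "cmod (f 0) \<le> cmod (g 0)" by simp
    have IH: "2 * pi * ln (cmod (g 0)) \<le> integral {0..2 * pi} (\<lambda>t. ln (cmod (g (of_real r * cis t))))"
    proof (rule Suc.IH[OF hol zeros])
      show "g 0 \<noteq> 0" using g0_ge' Suc.prems(3) by auto
      show "cmod (g w) \<le> M" if "cmod w = r" for w
        using circle Suc.prems(4) that by simp
      have "M < cmod (f 0) * (r / s) * (r / s) ^ k" using Suc.prems(5) by (simp add: mult.assoc)
      also have "\<dots> \<le> cmod (g 0) * (r / s) ^ k"
        using g0_ge r by (intro mult_right_mono) auto
      finally show "M < cmod (g 0) * (r / s) ^ k" .
    qed auto
    have "ln (cmod (f 0)) \<le> ln (cmod (g 0))"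
      using g0_ge' Suc.prems(3) by (subst ln_le_cancel_iff) auto
    then have "2 * pi * ln (cmod (f 0)) \<le> 2 * pi * ln (cmod (g 0))" by simp
    also note IH
    also have "(\<lambda>t. ln (cmod (g (of_real r * cis t)))) = (\<lambda>t. ln (cmod (f (of_real r * cis t))))"
      using r by (intro ext arg_cong[where f = ln] circle) (simp add: norm_mult)
    finally show ?thesis .
  qed
qed

lemma ln_cmod_le_circle_mean:
  assumes f: "f holomorphic_on ball z \<rho>" and r: "0 < r" "r < \<rho>" and fz: "f z \<noteq> 0"
    and nz: "\<And>w. w \<in> sphere z r \<Longrightarrow> f w \<noteq> 0"
  shows "2 * pi * ln (cmod (f z)) \<le> integral {0..2 * pi} (\<lambda>t. ln (cmod (f (z + of_real r * cis t))))"
proof -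
  define F where "F w = f (z + w)" for w
  have F: "F holomorphic_on ball 0 \<rho>"
    unfolding F_def by (intro holomorphic_on_compose_gen[OF _ f, unfolded o_def] holomorphic_intros)
      (auto simp: dist_norm)
  obtain u where u: "r < u" "u < \<rho>" using r dense by blast
  define Z where "Z = {w \<in> cball 0 u. F w = 0}"
  have "finite Z"
  proof (cases "F constant_on ball 0 \<rho>")
    case True
    then have "F w = F 0" if "w \<in> ball 0 \<rho>" for w
      using that r unfolding constant_on_def by (metis centre_in_ball less_trans)
    then have "Z = {}" using fz u by (auto simp: Z_def F_def)
    then show ?thesis by simp
  next
    case False
    then show ?thesis
      unfolding Z_def using u by (intro holomorphic_compact_finite_zeros[OF F]) auto
  qed
  have Z_r: "cmod w \<noteq> r" if "w \<in> Z" for w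
    using nz[of "z + w"] that by (auto simp: Z_def F_def dist_norm)
  \<comment> \<open>\<open>s\<close> and \<open>R\<close> bound an annulus around |w| = r in which
    \<open>F\<close> has no zeros. The entry r / 2 keeps \<open>s\<close> positive when there are no
    zeros inside; \<open>u\<close> keeps \<open>R\<close> within the disc whose zeros are listed in
    \<open>Z\<close>; r^2 / s ensures \<open>R * s \<le> r\<^sup>2\<close>.\<close>
  define s where "s = Max (insert (r / 2) {x \<in> cmod ` Z. x < r})"
  define R where "R = Min {u, Min (insert u {x \<in> cmod ` Z. r < x}), r\<^sup>2 / s}"
  have s: "s < r" "0 < s" "\<And>w. w \<in> Z \<Longrightarrow> cmod w < r \<Longrightarrow> cmod w \<le> s"
  proof -
    show "s < r" unfolding s_def using \<open>finite Z\<close> r by (subst Max_less_iff) auto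
    have "r / 2 \<le> s" unfolding s_def using \<open>finite Z\<close> by (intro Max_ge) auto
    then show "0 < s" using r by simp
    show "cmod w \<le> s" if "w \<in> Z" "cmod w < r" for w
      unfolding s_def using \<open>finite Z\<close> that by (intro Max_ge) auto
  qed
  have "r * s < r * r" using s r by (intro mult_strict_left_mono) auto
  then have "r < r\<^sup>2 / s" using s by (simp add: pos_less_divide_eq power2_eq_square)
  moreover have "r < Min (insert u {x \<in> cmod ` Z. r < x})"
    using \<open>finite Z\<close> u by (subst Min_gr_iff) auto
  ultimately have R: "r < R" "R \<le> u" "R \<le> r\<^sup>2 / s"
    using u by (simp_all add: R_def)
  have R_Z: "R \<le> cmod w" if "w \<in> Z" "r < cmod w" for w
  proof -
    have "Min (insert u {x \<in> cmod ` Z. r < x}) \<le> cmod w"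
      using \<open>finite Z\<close> that by (intro Min_le) auto
    then show ?thesis by (simp add: R_def)
  qed
  have cont: "continuous_on (sphere 0 r) F"
    using r by (intro continuous_on_subset[OF holomorphic_on_imp_continuous_on[OF F]]) auto
  have "bounded (F ` sphere 0 r)"
    by (intro compact_imp_bounded compact_continuous_image cont) simp
  then obtain M where "\<forall>x\<in>F ` sphere 0 r. cmod x \<le> M"
    unfolding bounded_iff by blast
  then have M: "cmod (F w) \<le> M" if "cmod w = r" for w
    using that by simp
  have F0: "F 0 \<noteq> 0" using fz by (simp add: F_def)
  obtain k where "M / cmod (F 0) < (r / s) ^ k"
    using real_arch_pow[of "r / s" "M / cmod (F 0)"] s by auto
  then have k: "M < cmod (F 0) * (r / s) ^ k"
    using F0 by (simp add: pos_divide_less_eq mult.commute)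
  have "2 * pi * ln (cmod (F 0)) \<le> integral {0..2 * pi} (\<lambda>t. ln (cmod (F (of_real r * cis t))))"
  proof (rule ln_cmod_le_circle_mean_aux[of s r R F M k])
    show "R * s \<le> r\<^sup>2" using R(3) s by (simp add: pos_le_divide_eq)
    show "F holomorphic_on ball 0 R" using R u by (intro holomorphic_on_subset[OF F]) auto
    show "cmod w \<le> s" if "w \<in> ball 0 R" "F w = 0" for w
    proof -
      have "w \<in> Z" using that R by (simp add: Z_def)
      then show ?thesis using s(3)[of w] R_Z[of w] Z_r[of w] that(1) by fastforce
    qed
  qed (use s R M k F0 in auto)
  then show ?thesis by (simp add: F_def)
qed

section \<open>Pairings with bump functions\<close>

lemma open_usc_less:
  assumes "open D" "usc_on D w"
  shows "open {z \<in> D. w z < c}"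
proof (rule topological_space_class.openI)
  fix z assume z: "z \<in> {z \<in> D. w z < c}"
  then have "\<forall>\<^sub>F x in at z. w x < c"
    using assms at_within_open[of z D] by (auto simp: usc_on_def)
  moreover have "\<forall>\<^sub>F x in at z. x \<in> D"
    using z assms(1) by (auto intro!: eventually_at_in_open')
  ultimately have "\<forall>\<^sub>F x in at z. x \<in> D \<and> w x < c"
    by eventually_elim auto
  then have "\<forall>\<^sub>F x in nhds z. x \<in> D \<and> w x < c"
    using z by (simp add: eventually_nhds_conv_at)
  then show "\<exists>T. open T \<and> z \<in> T \<and> T \<subseteq> {z \<in> D. w z < c}"
    unfolding eventually_nhds by blast
qed

lemma borel_measurable_usc:
  assumes "open D" "usc_on D w"
  shows "(\<lambda>z. if z \<in> D then w z else c) \<in> borel_measurable borel"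
proof (rule borel_measurableI_less)
  fix y
  have "{z \<in> space borel. (if z \<in> D then w z else c) < y} = {z \<in> D. w z < y} \<union> (if c < y then - D else {})"
    by auto
  moreover have "{z \<in> D. w z < y} \<in> sets borel" "- D \<in> sets borel"
    using open_usc_less[OF assms] assms(1) by auto
  ultimately show "{z \<in> space borel. (if z \<in> D then w z else c) < y} \<in> sets borel"
    by auto
qed

lemma usc_on_compact_bounded_above:
  assumes "open D" "usc_on D w" "compact K" "K \<subseteq> D" "\<And>z. z \<in> K \<Longrightarrow> w z < \<infinity>"
  obtains M where "0 \<le> M" "\<And>z. z \<in> K \<Longrightarrow> w z \<le> ereal M"
proof -
  have "K \<subseteq> (\<Union>n. {z \<in> D. w z < ereal (real n)})"
  proof
    fix z assume z: "z \<in> K"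
    then obtain n where "w z < ereal (real n)"
      using assms(5)[of z] less_PInf_Ex_of_nat by auto
    then show "z \<in> (\<Union>n. {z \<in> D. w z < ereal (real n)})"
      using z assms(4) by auto
  qed
  then obtain A where A: "finite A" "K \<subseteq> (\<Union>n\<in>A. {z \<in> D. w z < ereal (real n)})"
    using compactE_image[OF assms(3), of UNIV "\<lambda>n. {z \<in> D. w z < ereal (real n)}"]
      open_usc_less[OF assms(1,2)] by metis
  have "w z \<le> ereal (real (Max (insert 0 A)))" if z: "z \<in> K" for z
  proof -
    obtain n where n: "n \<in> A" "w z < ereal (real n)" using A(2) z by auto
    then have "n \<le> Max (insert 0 A)" using A(1) by (intro Max_ge) auto
    then have "ereal (real n) \<le> ereal (real (Max (insert 0 A)))" by simp
    with n(2) show ?thesis by (meson less_imp_le order_trans)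
  qed
  then show ?thesis by (rule that[OF of_nat_0_le_iff])
qed

section \<open>Masses of bumps and elementary estimates for pairings\<close>

definition bump_mass :: "real \<Rightarrow> real" where
  "bump_mass \<rho> = (LINT z|lborel. bump \<rho> 0 z)"

lemma bump_translate: "bump \<rho> z w = bump \<rho> 0 (w - z)"
  by (simp add: bump_def)

lemma bump_eq_0_outside: "0 \<le> \<rho> \<Longrightarrow> cball z \<rho> \<subseteq> K \<Longrightarrow> x \<notin> K \<Longrightarrow> bump \<rho> z x = 0"
  by (meson ball_subset_cball bump_eq_0 subsetD)

lemma borel_measurable_bump [measurable]: "bump \<rho> z \<in> borel_measurable borel"
  by (intro borel_measurable_continuous_onI continuous_on_bump)

lemma integrable_bump: "0 \<le> \<rho> \<Longrightarrow> integrable lborel (bump \<rho> z)"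
  by (rule Bochner_Integration.integrable_bound[OF integrable_real_indicator[of "cball z \<rho>"]])
    (use emeasure_lborel_cball_finite[of z \<rho>] in \<open>auto simp: bump_nonneg bump_le_1 bump_eq_0
      split: split_indicator intro!: AE_I2\<close>)

lemma bump_mass_eq_lborel: "0 \<le> \<rho> \<Longrightarrow> (LINT w|lborel. bump \<rho> z w) = bump_mass \<rho>"
  unfolding bump_mass_def
  by (subst lborel_distr_plus[of z, symmetric], subst integral_distr) (simp_all add: bump_translate[of \<rho> z])

lemma integrable_lebesgue_on_bump:
  assumes "0 \<le> \<rho>" "K \<in> sets lebesgue"
  shows "integrable (lebesgue_on K) (bump \<rho> z)"
proof -
  have "integrable lebesgue (bump \<rho> z)"
    using integrable_bump[OF assms(1)] by (simp add: integrable_completion)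
  from integrable_mult_indicator[OF assms(2) this]
  show ?thesis using assms(2) by (simp add: integrable_restrict_space)
qed

lemma bump_mass_eq:
  assumes "0 \<le> \<rho>" "K \<in> sets lebesgue" "cball z \<rho> \<subseteq> K"
  shows "(LINT w|lebesgue_on K. bump \<rho> z w) = bump_mass \<rho>"
proof -
  have "(LINT w|lebesgue_on K. bump \<rho> z w) = (LINT w|lebesgue. bump \<rho> z w)"
    using bump_eq_0_outside[OF assms(1,3)] assms(2) by (subst integral_restrict_space)
      (auto intro!: Bochner_Integration.integral_cong split: split_indicator)
  also have "\<dots> = (LINT w|lborel. bump \<rho> z w)"
    by (rule integral_completion) simp
  finally show ?thesis using assms(1) by (simp add: bump_mass_eq_lborel)
qed

lemma bump_mass_pos:
  assumes "0 < \<rho>"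
  shows "0 < bump_mass \<rho>"
proof -
  have "bump_mass \<rho> \<noteq> 0"
  proof
    assume "bump_mass \<rho> = 0"
    then have "AE z in lborel. bump \<rho> 0 z = 0"
      unfolding bump_mass_def using assms integrable_bump[of \<rho> 0]
      by (subst (asm) integral_nonneg_eq_0_iff_AE) (auto simp: bump_nonneg)
    then have "AE z in lborel. z \<notin> ball (0::complex) \<rho>"
      by eventually_elim (use bump_pos[of 0 _ \<rho>] in force)
    then have "emeasure lborel (ball (0::complex) \<rho>) = 0"
      by (subst (asm) AE_iff_null_sets[symmetric]) auto
    then show False
      using assms content_ball_pos[of \<rho> "0::complex"] by (simp add: measure_def)
  qed
  moreover have "0 \<le> bump_mass \<rho>"
    unfolding bump_mass_def by (simp add: bump_nonneg)
  ultimately show ?thesis by simp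
qed

lemma locally_integrable_on_AE_finite:
  assumes "locally_integrable_on D w" "compact K" "K \<subseteq> D"
  shows "AE z in lebesgue_on K. \<bar>w z\<bar> \<noteq> \<infinity>"
proof -
  have [measurable]: "w \<in> borel_measurable (lebesgue_on K)"
    and fin: "(\<integral>\<^sup>+z. e2ennreal \<bar>w z\<bar> \<partial>lebesgue_on K) < \<infinity>"
    using assms by (auto simp: locally_integrable_on_def)
  have "AE z in lebesgue_on K. e2ennreal \<bar>w z\<bar> \<noteq> \<infinity>"
    using fin by (intro nn_integral_PInf_AE) auto
  then show ?thesis
    by eventually_elim (auto simp: e2ennreal_infty)
qed

lemma locally_integrable_on_integrable:
  assumes "locally_integrable_on D w" "compact K" "K \<subseteq> D"
  shows "integrable (lebesgue_on K) (\<lambda>z. real_of_ereal (w z))"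
proof (rule integrableI_bounded)
  have [measurable]: "w \<in> borel_measurable (lebesgue_on K)"
    and fin: "(\<integral>\<^sup>+z. e2ennreal \<bar>w z\<bar> \<partial>lebesgue_on K) < \<infinity>"
    using assms by (auto simp: locally_integrable_on_def)
  show "(\<lambda>z. real_of_ereal (w z)) \<in> borel_measurable (lebesgue_on K)" by simp
  have "(\<integral>\<^sup>+z. ennreal (norm (real_of_ereal (w z))) \<partial>lebesgue_on K)
      = (\<integral>\<^sup>+z. e2ennreal \<bar>w z\<bar> \<partial>lebesgue_on K)"
    by (rule nn_integral_cong_AE, use locally_integrable_on_AE_finite[OF assms] in eventually_elim)
      (auto simp flip: e2ennreal_ereal simp: ereal_real')
  then show "(\<integral>\<^sup>+z. ennreal (norm (real_of_ereal (w z))) \<partial>lebesgue_on K) < \<infinity>"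
    using fin by simp
qed

lemma integrable_mult_locally_integrable:
  assumes "locally_integrable_on D w" "compact K" "K \<subseteq> D" "continuous_on K \<phi>"
  shows "integrable (lebesgue_on K) (\<lambda>z. \<phi> z * real_of_ereal (w z))"
proof -
  have "bounded (\<phi> ` K)" using assms by (intro compact_imp_bounded compact_continuous_image)
  then obtain B where B: "\<And>z. z \<in> K \<Longrightarrow> \<bar>\<phi> z\<bar> \<le> B" unfolding bounded_iff by auto
  have [measurable]: "\<phi> \<in> borel_measurable (lebesgue_on K)"
    using assms by (intro continuous_imp_measurable_on_sets_lebesgue) (auto simp: compact_imp_closed)
  note int = locally_integrable_on_integrable[OF assms(1-3)]
  show ?thesis
  proof (rule Bochner_Integration.integrable_bound)
    show "integrable (lebesgue_on K) (\<lambda>z. B * real_of_ereal (w z))" using int by simp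
    show "AE z in lebesgue_on K. norm (\<phi> z * real_of_ereal (w z)) \<le> norm (B * real_of_ereal (w z))"
      by (intro AE_I2) (auto simp: abs_mult intro!: mult_right_mono order_trans[OF B abs_ge_self] real_of_ereal_pos)
  qed (use int in measurable)
qed

text \<open>Local integrability speaks of compact sets only, whereas the pairing integrates over
  \<open>D\<close>; this moves the integral to a compact set outside which the test function
  vanishes.\<close>

lemma distr_pairing_eq:
  assumes "open D" "compact K" "K \<subseteq> D" "\<And>z. z \<notin> K \<Longrightarrow> \<phi> z = 0"
  shows "distr_pairing D w \<phi> = (LINT z|lebesgue_on K. \<phi> z * real_of_ereal (w z))"
  unfolding distr_pairing_def using assms
  by (subst (1 2) integral_restrict_space)
    (auto simp: compact_imp_closed intro!: Bochner_Integration.integral_cong split: split_indicator)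

lemma distr_pairing_bump:
  assumes "open D" "0 \<le> \<rho>" "cball z \<rho> \<subseteq> D"
  shows "distr_pairing D w (bump \<rho> z) = (LINT x|lebesgue_on (cball z \<rho>). bump \<rho> z x * real_of_ereal (w x))"
  using assms by (intro distr_pairing_eq) (auto intro: bump_eq_0)

lemma distr_pairing_bump_le:
  assumes "open D" "locally_integrable_on D w" "0 \<le> \<rho>" "cball z \<rho> \<subseteq> D"
    and "\<And>x. x \<in> cball z \<rho> \<Longrightarrow> w x \<le> ereal c"
  shows "distr_pairing D w (bump \<rho> z) \<le> c * bump_mass \<rho>"
proof -
  let ?K = "cball z \<rho>"
  have int: "integrable (lebesgue_on ?K) (\<lambda>x. bump \<rho> z x * c)"
    by (intro integrable_mult_left integrable_lebesgue_on_bump assms) simp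
  have "distr_pairing D w (bump \<rho> z) = (LINT x|lebesgue_on ?K. bump \<rho> z x * real_of_ereal (w x))"
    by (rule distr_pairing_bump[OF assms(1,3,4)])
  also have "\<dots> \<le> (LINT x|lebesgue_on ?K. bump \<rho> z x * c)"
  proof (rule integral_mono_AE[OF integrable_mult_locally_integrable[OF assms(2) _ assms(4)] int])
    show "AE x in lebesgue_on ?K. bump \<rho> z x * real_of_ereal (w x) \<le> bump \<rho> z x * c"
      using locally_integrable_on_AE_finite[OF assms(2) compact_cball assms(4)] AE_space
    proof eventually_elim
      case (elim x)
      then have "w x \<le> ereal c" using assms(5) by simp
      with elim have "real_of_ereal (w x) \<le> c" by (cases "w x") auto
      then show ?case by (intro mult_left_mono bump_nonneg)
    qed
  qed (auto intro: continuous_on_bump)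
  also have "\<dots> = bump_mass \<rho> * c"
    using bump_mass_eq[OF assms(3) _ order_refl, of z] by simp
  finally show ?thesis by (simp add: mult.commute)
qed

text \<open>The radial kernel estimate is applied to M - w, where M bounds w on the disc, so that
  only nonnegative integrals occur. The assumption \<open>circles\<close> has this form, and
  tolerates a null set of exceptions, in order to cover both subharmonic functions and logarithms
  whose zeros lie on some of the circles.\<close>

lemma submean_pairing_bump:
  assumes D: "open D" "usc_on D w" "\<And>x. x \<in> D \<Longrightarrow> w x < \<infinity>" "locally_integrable_on D w"
    and \<rho>: "0 < \<rho>" "cball z \<rho> \<subseteq> D"
    and circles: "\<And>M. 0 \<le> M \<Longrightarrow> (\<And>x. x \<in> cball z \<rho> \<Longrightarrow> w x \<le> ereal M) \<Longrightarrow>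
      AE x :: complex in lborel. 0 < norm x \<and> norm x < \<rho> \<longrightarrow>
        (\<integral>\<^sup>+t. e2ennreal (ereal M - w (z + of_real (norm x) * cis t)) \<partial>lebesgue_on {0..2 * pi})
          \<le> ennreal (2 * pi) * e2ennreal (ereal M - w z)"
  shows "w z * ereal (bump_mass \<rho>) \<le> ereal (distr_pairing D w (bump \<rho> z))"
proof (cases "w z")
  case MInf
  then show ?thesis using bump_mass_pos[OF \<rho>(1)] by simp
next
  case PInf
  moreover have "z \<in> D" using \<rho> by (metis centre_in_cball less_imp_le subsetD)
  ultimately show ?thesis using D(3)[of z] by simp
next
  case (real a)
  let ?K = "cball z \<rho>"
  obtain M where M: "0 \<le> M" "\<And>x. x \<in> ?K \<Longrightarrow> w x \<le> ereal M"
    using usc_on_compact_bounded_above[OF D(1,2) compact_cball \<rho>(2)] D(3) \<rho>(2) by (metis subsetD)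
  define G where "G x = (if x \<in> ?K then e2ennreal (ereal M - w x) else 0)" for x
  define k where "k x = ennreal (bump \<rho> 0 x)" for x
  have [measurable]: "k \<in> borel_measurable borel" unfolding k_def by measurable
  have "G = (\<lambda>x. if x \<in> ?K then e2ennreal (ereal M - (if x \<in> D then w x else 0)) else 0)"
    using \<rho>(2) by (auto simp: G_def fun_eq_iff)
  moreover note borel_measurable_usc[OF D(1,2), of 0, measurable]
  ultimately have [measurable]: "G \<in> borel_measurable borel" by simp
  have "(\<integral>\<^sup>+x. k (x - z) * G x \<partial>lborel) \<le> e2ennreal (ereal M - w z) * (\<integral>\<^sup>+x. k x \<partial>lborel)"
  proof (rule nn_integral_radial_kernel_le)
    show "k x = k y" if "norm x = norm y" for x y
      using that by (simp add: k_def bump_def)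
    have "AE x in lborel. x \<noteq> (0::complex)" by (rule AE_lborel_singleton)
    moreover have "AE x :: complex in lborel. 0 < norm x \<and> norm x < \<rho> \<longrightarrow>
        (\<integral>\<^sup>+t. e2ennreal (ereal M - w (z + of_real (norm x) * cis t)) \<partial>lebesgue_on {0..2 * pi})
          \<le> ennreal (2 * pi) * e2ennreal (ereal M - w z)"
      by (rule circles[OF M(1)]) (rule M(2))
    ultimately show "AE x in lborel. k x \<noteq> 0 \<longrightarrow>
      (\<integral>\<^sup>+t. G (z + of_real (norm x) * cis t) \<partial>lebesgue_on {0..2 * pi})
        \<le> ennreal (2 * pi) * e2ennreal (ereal M - w z)"
    proof eventually_elim
      case (elim x)
      show ?case
      proof
        assume "k x \<noteq> 0"
        then have "bump \<rho> 0 x \<noteq> 0" by (auto simp: k_def)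
        then have x: "norm x < \<rho>"
          using bump_eq_0[of \<rho> x 0] \<rho>(1) by (meson less_imp_le mem_ball_0)
        have "G (z + of_real (norm x) * cis t) = e2ennreal (ereal M - w (z + of_real (norm x) * cis t))" for t
          using x by (simp add: G_def dist_norm norm_mult)
        then show "(\<integral>\<^sup>+t. G (z + of_real (norm x) * cis t) \<partial>lebesgue_on {0..2 * pi})
          \<le> ennreal (2 * pi) * e2ennreal (ereal M - w z)"
          using elim x by simp
      qed
    qed
  qed measurable
  also have "(\<integral>\<^sup>+x. k x \<partial>lborel) = ennreal (bump_mass \<rho>)"
    unfolding k_def bump_mass_def using \<rho>(1)
    by (intro nn_integral_eq_integral integrable_bump AE_I2 bump_nonneg) auto
  also have "e2ennreal (ereal M - w z) = ennreal (M - a)"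
    using real by simp
  also have "ennreal (M - a) * ennreal (bump_mass \<rho>) = ennreal ((M - a) * bump_mass \<rho>)"
    using M(2)[of z] real \<rho>(1) by (intro ennreal_mult[symmetric]) (auto simp: bump_mass_pos less_imp_le)
  finally have le: "(\<integral>\<^sup>+x. k (x - z) * G x \<partial>lborel) \<le> ennreal ((M - a) * bump_mass \<rho>)" .
  \<comment> \<open>The real-valued integrand of the pairing with M - w. It agrees almost everywhere
    with the kernel integrand, because a locally integrable w is finite almost everywhere.\<close>
  define h where "h x = bump \<rho> z x * M - bump \<rho> z x * real_of_ereal (w x)" for x
  have intM: "integrable (lebesgue_on ?K) (\<lambda>x. bump \<rho> z x * M)"
    using \<rho>(1) by (intro integrable_mult_left integrable_lebesgue_on_bump) auto
  note intw = integrable_mult_locally_integrable[OF D(4) compact_cball \<rho>(2) continuous_on_bump, of \<rho> z]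
  have "(\<integral>\<^sup>+x. ennreal (h x) \<partial>lebesgue_on ?K) = (\<integral>\<^sup>+x. k (x - z) * G x \<partial>lebesgue_on ?K)"
  proof (rule nn_integral_cong_AE)
    show "AE x in lebesgue_on ?K. ennreal (h x) = k (x - z) * G x"
      using locally_integrable_on_AE_finite[OF D(4) compact_cball \<rho>(2)] AE_space
    proof eventually_elim
      case (elim x)
      then obtain b where b: "w x = ereal b" by (cases "w x") auto
      then have "b \<le> M" using M(2)[of x] elim by simp
      then show ?case
        using elim b by (simp add: h_def k_def G_def bump_translate[of \<rho> z x] bump_nonneg
            flip: ennreal_mult right_diff_distrib)
    qed
  qed
  also have "\<dots> = (\<integral>\<^sup>+x. k (x - z) * G x * indicator ?K x \<partial>lborel)"
    by (subst nn_integral_restrict_space) (simp_all add: nn_integral_completion)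
  also have "\<dots> = (\<integral>\<^sup>+x. k (x - z) * G x \<partial>lborel)"
    by (intro nn_integral_cong) (auto simp: G_def split: split_indicator)
  finally have "(\<integral>\<^sup>+x. ennreal (h x) \<partial>lebesgue_on ?K) \<le> ennreal ((M - a) * bump_mass \<rho>)"
    using le by simp
  moreover have "(\<integral>\<^sup>+x. ennreal (h x) \<partial>lebesgue_on ?K) = ennreal (LINT x|lebesgue_on ?K. h x)"
  proof (rule nn_integral_eq_integral)
    show "integrable (lebesgue_on ?K) h"
      unfolding h_def by (intro Bochner_Integration.integrable_diff intM intw)
    show "AE x in lebesgue_on ?K. 0 \<le> h x"
      using locally_integrable_on_AE_finite[OF D(4) compact_cball \<rho>(2)] AE_space
    proof eventually_elim
      case (elim x)
      then obtain b where b: "w x = ereal b" by (cases "w x") auto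
      then have "b \<le> M" using M(2)[of x] elim by simp
      then show ?case
        using b by (simp add: h_def bump_nonneg mult_left_mono)
    qed
  qed
  ultimately have "(LINT x|lebesgue_on ?K. h x) \<le> (M - a) * bump_mass \<rho>"
    using M(2)[of z] real \<rho>(1) bump_mass_pos[OF \<rho>(1)] by (simp add: ennreal_le_iff)
  moreover have "(LINT x|lebesgue_on ?K. h x) = bump_mass \<rho> * M - distr_pairing D w (bump \<rho> z)"
    unfolding h_def using \<rho> bump_mass_eq[OF _ _ order_refl, of \<rho> z]
    by (subst Bochner_Integration.integral_diff[OF intM intw]) (simp add: distr_pairing_bump[OF D(1)])
  ultimately show ?thesis using real by (simp add: algebra_simps)
qed

text \<open>With x+ and x- for the positive and negative part, (M - x)+ + x+ = M + x- whenever x <=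
  M and M >= 0. Integrating this, the positive part has a finite integral and can be cancelled,
  which turns the submean inequality for w into an inequality for M - w.\<close>

lemma nn_integral_le_of_le_circle_mean:
  assumes M: "0 \<le> M" "\<And>t. w (z + of_real r * cis t) \<le> ereal M"
    and meas [measurable]: "(\<lambda>t. w (z + of_real r * cis t)) \<in> borel_measurable (lebesgue_on {0..2 * pi})"
    and le: "w z \<le> circle_mean w z r"
  shows "(\<integral>\<^sup>+t. e2ennreal (ereal M - w (z + of_real r * cis t)) \<partial>lebesgue_on {0..2 * pi})
    \<le> ennreal (2 * pi) * e2ennreal (ereal M - w z)"
proof -
  define \<mu> where "\<mu> = lebesgue_on {0..2 * pi}"
  define g where "g t = w (z + of_real r * cis t)" for t
  have [measurable]: "g \<in> borel_measurable \<mu>" unfolding g_def[abs_def] \<mu>_def by (rule meas)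
  have space: "emeasure \<mu> (space \<mu>) = ennreal (2 * pi)"
    by (simp add: \<mu>_def emeasure_restrict_space)
  define A where "A = (\<integral>\<^sup>+t. e2ennreal (ereal M - g t) \<partial>\<mu>)"
  define P where "P = (\<integral>\<^sup>+t. e2ennreal (g t) \<partial>\<mu>)"
  define N where "N = (\<integral>\<^sup>+t. e2ennreal (- g t) \<partial>\<mu>)"
  have "e2ennreal (ereal M - x) + e2ennreal x = ennreal M + e2ennreal (- x)" if "x \<le> ereal M" for x
  proof (cases x)
    case (real a)
    with that have "a \<le> M" by simp
    with real M(1) show ?thesis
      by (cases "0 \<le> a") (simp_all add: ennreal_plus[symmetric] ennreal_neg del: ennreal_plus)
  next
    case MInf
    then show ?thesis by (simp add: e2ennreal_infty)
  qed (use that in auto)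
  then have "(\<integral>\<^sup>+t. e2ennreal (ereal M - g t) + e2ennreal (g t) \<partial>\<mu>)
      = (\<integral>\<^sup>+t. ennreal M + e2ennreal (- g t) \<partial>\<mu>)"
    using M(2) by (simp add: g_def)
  then have sum: "A + P = ennreal (2 * pi * M) + N"
    unfolding A_def P_def N_def using M(1)
    by (subst (asm) (1 2) nn_integral_add) (simp_all add: space ennreal_mult[symmetric] mult.commute)
  have "P \<le> (\<integral>\<^sup>+t. ennreal M \<partial>\<mu>)"
    unfolding P_def using M(2) by (intro nn_integral_mono) (metis g_def e2ennreal_mono e2ennreal_ereal)
  also have "\<dots> < \<infinity>" by (simp add: space ennreal_mult_less_top)
  finally obtain p where p: "0 \<le> p" "P = ennreal p" by (cases P) auto
  have mean: "circle_mean w z r = (enn2ereal P - enn2ereal N) / ereal (2 * pi)"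
    by (simp add: circle_mean_def P_def N_def g_def \<mu>_def)
  have "A \<le> ennreal (2 * pi) * e2ennreal (ereal M - w z)"
  proof (cases "w z = - \<infinity>")
    case True
    then show ?thesis by (simp add: e2ennreal_infty ennreal_mult_top)
  next
    case False
    have "N \<noteq> \<infinity>"
    proof
      assume "N = \<infinity>"
      then have "circle_mean w z r = - \<infinity>" by (simp add: mean p)
      with le False show False by simp
    qed
    then obtain n where n: "0 \<le> n" "N = ennreal n" by (cases N) auto
    have m: "circle_mean w z r = ereal ((p - n) / (2 * pi))"
      using p n by (simp add: mean enn2ereal_ennreal)
    then obtain a where a: "w z = ereal a" using le False by (cases "w z") auto
    have "a \<le> (p - n) / (2 * pi)" using le a m by simp
    then have a_le: "2 * pi * a \<le> p - n" by (simp add: pos_le_divide_eq mult.commute)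
    have "A + ennreal p = ennreal (2 * pi * M + n)"
      using sum p n M(1) by simp
    moreover obtain b where b: "0 \<le> b" "A = ennreal b"
      using calculation by (cases A) auto
    ultimately have "b + p = 2 * pi * M + n"
      using p n M(1) by (simp flip: ennreal_plus)
    then have "b \<le> 2 * pi * (M - a)" using a_le by (simp add: algebra_simps)
    then have "ennreal b \<le> ennreal (2 * pi * (M - a))" by (rule ennreal_leI)
    also have "\<dots> = ennreal (2 * pi) * ennreal (M - a)" by (rule ennreal_mult') simp
    finally show ?thesis using a b by simp
  qed
  then show ?thesis by (simp add: A_def g_def \<mu>_def)
qed

text \<open>The radius is limited by the one that \<open>subharmonic_on\<close> provides at
  \<open>z\<close>. This is harmless since limit functions are only evaluated at one point at a
  time.\<close>

lemma subharmonic_on_submean_bump: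
  assumes "open D" "subharmonic_on D w" "locally_integrable_on D w" "z \<in> D"
  shows "\<exists>\<rho>0>0. \<forall>\<rho>. 0 < \<rho> \<and> \<rho> \<le> \<rho>0 \<longrightarrow>
    cball z \<rho> \<subseteq> D \<and> w z * ereal (bump_mass \<rho>) \<le> ereal (distr_pairing D w (bump \<rho> z))"
proof -
  have fin: "\<And>x. x \<in> D \<Longrightarrow> w x < \<infinity>" and usc: "usc_on D w"
    using assms by (auto simp: subharmonic_on_def)
  obtain \<rho>0 where \<rho>0: "0 < \<rho>0" "cball z \<rho>0 \<subseteq> D"
    "\<And>r. 0 < r \<Longrightarrow> r \<le> \<rho>0 \<Longrightarrow> w z \<le> circle_mean w z r"
    using assms(2,4) by (auto simp: subharmonic_on_def)
  have sub: "cball z \<rho> \<subseteq> D" if "\<rho> \<le> \<rho>0" for \<rho>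
    using \<rho>0(2) that by (meson subset_cball order_trans)
  show ?thesis
  proof (intro exI[of _ \<rho>0] conjI allI impI, goal_cases)
    case 1
    show ?case by (rule \<rho>0(1))
  next
    case (2 \<rho>)
    then show ?case using sub by blast
  next
    case (3 \<rho>)
    then have \<rho>: "0 < \<rho>" "\<rho> \<le> \<rho>0" by auto
    show "w z * ereal (bump_mass \<rho>) \<le> ereal (distr_pairing D w (bump \<rho> z))"
    proof (rule submean_pairing_bump[OF assms(1) usc fin assms(3) \<rho>(1) sub[OF \<rho>(2)]])
      fix M assume M: "0 \<le> M" "\<And>x. x \<in> cball z \<rho> \<Longrightarrow> w x \<le> ereal M"
      show "AE x :: complex in lborel. 0 < norm x \<and> norm x < \<rho> \<longrightarrow>
        (\<integral>\<^sup>+t. e2ennreal (ereal M - w (z + of_real (norm x) * cis t)) \<partial>lebesgue_on {0..2 * pi})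
          \<le> ennreal (2 * pi) * e2ennreal (ereal M - w z)"
      proof (intro AE_I2 impI)
        fix x :: complex assume x: "0 < norm x \<and> norm x < \<rho>"
        have circle: "z + of_real (norm x) * cis t \<in> cball z \<rho>" for t
          using x by (simp add: dist_norm norm_mult)
        let ?w = "\<lambda>z. if z \<in> D then w z else 0"
        have [measurable]: "?w \<in> borel_measurable borel"
          by (rule borel_measurable_usc[OF assms(1) usc])
        have "(\<lambda>t. z + of_real (norm x) * cis t) \<in> borel_measurable borel"
          by (intro borel_measurable_continuous_onI continuous_intros)
        then have "(\<lambda>t. ?w (z + of_real (norm x) * cis t)) \<in> borel_measurable lborel"
          by measurable
        then have "(\<lambda>t. ?w (z + of_real (norm x) * cis t)) \<in> borel_measurable (lebesgue_on {0..2 * pi})"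
          by (intro measurable_restrict_space1 measurable_completion)
        moreover have "(\<lambda>t. ?w (z + of_real (norm x) * cis t)) = (\<lambda>t. w (z + of_real (norm x) * cis t))"
          using circle sub[OF \<rho>(2)] by (metis subsetD)
        ultimately show "(\<integral>\<^sup>+t. e2ennreal (ereal M - w (z + of_real (norm x) * cis t)) \<partial>lebesgue_on {0..2 * pi})
            \<le> ennreal (2 * pi) * e2ennreal (ereal M - w z)"
          using x \<rho>(2) by (intro nn_integral_le_of_le_circle_mean M circle \<rho>0(3)) auto
      qed
    qed
  qed
qed

section \<open>Scaled logarithms of holomorphic functions\<close>

lemma scaled_log_abs_nonzero: "x \<noteq> 0 \<Longrightarrow> ereal c * log_abs x = ereal (c * ln (cmod x))"
  by (simp add: log_abs_def)

lemma scaled_log_abs_zero: "0 < c \<Longrightarrow> ereal c * log_abs 0 = - \<infinity>"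
  by (simp add: log_abs_def)

lemma scaled_log_abs_le_iff:
  assumes "0 < c"
  shows "ereal c * log_abs x \<le> ereal b \<longleftrightarrow> cmod x \<le> exp (b / c)"
proof (cases "x = 0")
  case False
  have "c * ln (cmod x) \<le> b \<longleftrightarrow> ln (cmod x) \<le> b / c"
    using assms by (simp add: pos_le_divide_eq mult.commute)
  also have "\<dots> \<longleftrightarrow> cmod x \<le> exp (b / c)"
    using False by (metis exp_le_cancel_iff exp_ln zero_less_norm_iff)
  finally show ?thesis using False by (simp add: scaled_log_abs_nonzero)
qed (use assms in \<open>simp add: scaled_log_abs_zero\<close>)

lemma usc_on_scaled_log_abs:
  assumes "continuous_on D f" "0 < c"
  shows "usc_on D (\<lambda>z. ereal c * log_abs (f z))"
  unfolding usc_on_def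
proof (intro ballI allI impI)
  fix z y assume z: "z \<in> D" and less: "ereal c * log_abs (f z) < y"
  obtain b where b: "ereal c * log_abs (f z) < ereal b" "ereal b < y"
    using ereal_dense2[OF less] by blast
  have "cmod (f z) < exp (b / c)"
  proof (cases "f z = 0")
    case False
    then have "c * ln (cmod (f z)) < b" using b(1) by (simp add: scaled_log_abs_nonzero)
    then have "ln (cmod (f z)) < b / c" using assms(2) by (simp add: pos_less_divide_eq mult.commute)
    then have "exp (ln (cmod (f z))) < exp (b / c)" by (simp only: exp_less_cancel_iff)
    then show ?thesis using False by simp
  qed simp
  moreover have "((\<lambda>x. cmod (f x)) \<longlongrightarrow> cmod (f z)) (at z within D)"
    using assms(1) z by (intro tendsto_norm) (simp add: continuous_on)
  ultimately have "\<forall>\<^sub>F x in at z within D. cmod (f x) < exp (b / c)"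
    by (rule order_tendstoD(2)[rotated])
  then show "\<forall>\<^sub>F x in at z within D. ereal c * log_abs (f x) < y"
  proof eventually_elim
    case (elim x)
    then have "ereal c * log_abs (f x) \<le> ereal b"
      using scaled_log_abs_le_iff[OF assms(2)] by simp
    then show ?case using b(2) by (rule le_less_trans)
  qed
qed

text \<open>Used to discard the circles that pass through zeros of a holomorphic function, so that
  no integral of a logarithm with singularities has to be computed.\<close>

lemma negligible_norm_in_countable:
  assumes "countable E"
  shows "AE x :: complex in lborel. norm x \<notin> E"
proof -
  have "negligible (\<Union>r\<in>E. sphere (0::complex) r)"
    using assms by (intro negligible_countable_Union) (auto intro: negligible_sphere)
  then have "(\<Union>r\<in>E. sphere (0::complex) r) \<in> null_sets lebesgue"
    by (simp add: negligible_iff_null_sets)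
  then have "AE x in lebesgue. x \<notin> (\<Union>r\<in>E. sphere (0::complex) r)"
    by (rule AE_not_in)
  then have "AE x in lborel. x \<notin> (\<Union>r\<in>E. sphere (0::complex) r)"
    by (simp add: AE_completion_iff)
  then show ?thesis
    by eventually_elim auto
qed

text \<open>The radius is restricted by \<open>D\<close> alone and not by f, which makes the
  inequality usable for a whole sequence at once. If f z is nonzero, the zeros in the open disc are
  countable, being finite in each smaller concentric closed disc; on all other circles the mean
  value estimate for ln |f| applies.\<close>

lemma log_abs_submean_bump:
  assumes "open D" "f holomorphic_on D" "0 < c"
    and w: "w = (\<lambda>z. ereal c * log_abs (f z))" "locally_integrable_on D w"
    and \<rho>: "0 < \<rho>" "cball z \<rho> \<subseteq> D"
  shows "w z * ereal (bump_mass \<rho>) \<le> ereal (distr_pairing D w (bump \<rho> z))"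
proof (cases "f z = 0")
  case True
  then show ?thesis
    using bump_mass_pos[OF \<rho>(1)] by (simp add: w scaled_log_abs_zero[OF assms(3)])
next
  case False
  have usc: "usc_on D w"
    unfolding w using assms(2,3) by (intro usc_on_scaled_log_abs holomorphic_on_imp_continuous_on)
  have fin: "w x < \<infinity>" for x
    using assms(3) by (cases "f x = 0") (simp_all add: w scaled_log_abs_zero scaled_log_abs_nonzero)
  have ball: "f holomorphic_on ball z \<rho>"
    using assms(2) \<rho>(2) by (meson ball_subset_cball holomorphic_on_subset order_trans)
  have "countable {x \<in> ball z \<rho>. f x = 0}"
  proof (cases "f constant_on ball z \<rho>")
    case True
    then have "f x = f z" if "x \<in> ball z \<rho>" for x
      using that \<rho>(1) unfolding constant_on_def by (metis centre_in_ball)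
    then have "{x \<in> ball z \<rho>. f x = 0} = {}" using False by auto
    then show ?thesis by (simp only: countable_empty)
  next
    case False
    have "cball z (\<rho> - inverse (real (Suc n))) \<subseteq> ball z \<rho>" for n
      by (rule cball_subset_ball_iff[THEN iffD2]) simp
    then have "finite {x \<in> cball z (\<rho> - inverse (real (Suc n))). f x = 0}" for n
      using False by (intro holomorphic_compact_finite_zeros[OF ball]) auto
    then have "countable (\<Union>n. {x \<in> cball z (\<rho> - inverse (real (Suc n))). f x = 0})"
      by (intro countable_UN[OF countableI_type countable_finite])
    moreover have "{x \<in> ball z \<rho>. f x = 0} \<subseteq> (\<Union>n. {x \<in> cball z (\<rho> - inverse (real (Suc n))). f x = 0})"
    proof
      fix x assume x: "x \<in> {x \<in> ball z \<rho>. f x = 0}"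
      then obtain n where "inverse (real (Suc n)) < \<rho> - dist z x"
        using reals_Archimedean[of "\<rho> - dist z x"] by auto
      then have "x \<in> {x \<in> cball z (\<rho> - inverse (real (Suc n))). f x = 0}"
        using x by simp
      then show "x \<in> (\<Union>n. {x \<in> cball z (\<rho> - inverse (real (Suc n))). f x = 0})" by blast
    qed
    ultimately show ?thesis by (rule countable_subset[rotated])
  qed
  then have E: "countable ((\<lambda>x. norm (x - z)) ` {x \<in> ball z \<rho>. f x = 0})" (is "countable ?E")
    by (rule countable_image)
  show ?thesis
  proof (rule submean_pairing_bump[OF assms(1) usc fin w(2) \<rho>])
    fix M assume M: "0 \<le> M" "\<And>x. x \<in> cball z \<rho> \<Longrightarrow> w x \<le> ereal M"
    show "AE x :: complex in lborel. 0 < norm x \<and> norm x < \<rho> \<longrightarrow>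
      (\<integral>\<^sup>+t. e2ennreal (ereal M - w (z + of_real (norm x) * cis t)) \<partial>lebesgue_on {0..2 * pi})
        \<le> ennreal (2 * pi) * e2ennreal (ereal M - w z)"
      using negligible_norm_in_countable[OF E]
    proof eventually_elim
      case (elim x)
      show ?case
      proof
        assume x: "0 < norm x \<and> norm x < \<rho>"
        let ?p = "\<lambda>t. z + of_real (norm x) * cis t"
        have nz: "f y \<noteq> 0" if "y \<in> sphere z (norm x)" for y
        proof
          assume "f y = 0"
          then have "norm (y - z) \<in> ?E" using that x by (auto simp: dist_norm)
          then show False using elim that by (simp add: dist_norm norm_minus_commute)
        qed
        have circle: "?p t \<in> sphere z (norm x)" for t
          by (simp add: dist_norm norm_mult)
        define h where "h t = M - c * ln (cmod (f (?p t)))" for t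
        have h: "e2ennreal (ereal M - w (?p t)) = ennreal (h t)" for t
          using nz[OF circle] by (simp add: w h_def scaled_log_abs_nonzero)
        have h_nonneg: "0 \<le> h t" for t
        proof -
          have "w (?p t) \<le> ereal M" using x circle[of t] by (intro M) auto
          then show ?thesis using nz[OF circle] by (simp add: w h_def scaled_log_abs_nonzero)
        qed
        have cont: "continuous_on {0..2 * pi} (\<lambda>t. ln (cmod (f (?p t))))"
        proof (intro continuous_on_ln continuous_on_norm ballI)
          show "continuous_on {0..2 * pi} (\<lambda>t. f (?p t))"
            using x circle by (intro continuous_on_compose2[OF holomorphic_on_imp_continuous_on[OF ball]])
              (auto intro!: continuous_intros)
        qed (use nz[OF circle] in simp)
        have int_ln: "(\<lambda>t. ln (cmod (f (?p t)))) integrable_on {0..2 * pi}"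
          using integrable_continuous_real[OF cont] .
        have "continuous_on {0..2 * pi} h"
          unfolding h_def by (intro continuous_intros cont)
        then have int: "integrable (lebesgue_on {0..2 * pi}) h"
          by (rule continuous_imp_integrable_real)
        have "(\<integral>\<^sup>+t. e2ennreal (ereal M - w (?p t)) \<partial>lebesgue_on {0..2 * pi})
            = ennreal (LINT t|lebesgue_on {0..2 * pi}. h t)"
          unfolding h by (intro nn_integral_eq_integral int AE_I2 h_nonneg)
        also have "(LINT t|lebesgue_on {0..2 * pi}. h t) = integral {0..2 * pi} h"
          by (intro lebesgue_integral_eq_integral int) simp
        also have "\<dots> = 2 * pi * M - c * integral {0..2 * pi} (\<lambda>t. ln (cmod (f (?p t))))"
          unfolding h_def using int_ln by (subst Henstock_Kurzweil_Integration.integral_diff)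
            (auto intro: integrable_on_mult_right)
        also have "\<dots> \<le> 2 * pi * M - c * (2 * pi * ln (cmod (f z)))"
          using ln_cmod_le_circle_mean[OF ball _ _ False nz] x assms(3)
          by (intro diff_left_mono mult_left_mono) auto
        also have "\<dots> = 2 * pi * (M - c * ln (cmod (f z)))" by (simp add: algebra_simps)
        also have "ennreal \<dots> = ennreal (2 * pi) * e2ennreal (ereal M - w z)"
          using False by (simp add: w scaled_log_abs_nonzero ennreal_mult')
        finally show "(\<integral>\<^sup>+t. e2ennreal (ereal M - w (?p t)) \<partial>lebesgue_on {0..2 * pi})
            \<le> ennreal (2 * pi) * e2ennreal (ereal M - w z)"
          by (simp add: ennreal_leI)
      qed
    qed
  qed
qed

section \<open>Upper bounds from weak convergence\<close>

lemma abs_add_eq_of_same_sign: "0 \<le> x * y \<Longrightarrow> \<bar>x + y\<bar> = \<bar>x\<bar> + \<bar>y\<bar>" for x y :: real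
  by (auto simp: abs_if zero_le_mult_iff)

text \<open>The k-th partial sum as a function of the functional \<open>n\<close>. All functionals
  are carried along because the sign of the k-th term is read off from the functional
  \<open>k\<close>.\<close>

primrec hump_partial :: "(nat \<Rightarrow> nat \<Rightarrow> real) \<Rightarrow> nat \<Rightarrow> nat \<Rightarrow> real" where
  "hump_partial a 0 = (\<lambda>n. 0)"
| "hump_partial a (Suc k) = (\<lambda>n. hump_partial a k n +
     (if 0 \<le> hump_partial a k k * a k k then 1 else - 1) * (1 / 3) ^ k * a n k)"

text \<open>The gliding hump of Sokal's proof of the uniform boundedness principle: the \<open>k\<close>-th sign is
  chosen so that the \<open>k\<close>-th functional sees no cancellation between the \<open>k\<close>-th term and the sum of
  the earlier ones, while the later terms are too small to compensate.\<close>

lemma gliding_hump: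
  fixes a :: "nat \<Rightarrow> nat \<Rightarrow> real"
  assumes bound: "\<And>k j. \<bar>a k j\<bar> \<le> S k" and large: "\<And>k. 2 / 3 * S k \<le> \<bar>a k k\<bar>"
  obtains s where "\<And>j. \<bar>s j\<bar> = 1"
    "\<And>k. (1 / 3) ^ k * S k / 6 \<le> \<bar>\<Sum>j. s j * (1 / 3) ^ j * a k j\<bar>"
proof -
  define s where "s k = (if 0 \<le> hump_partial a k k * a k k then 1 else - 1 :: real)" for k
  have s: "\<bar>s j\<bar> = 1" for j by (simp add: s_def)
  have partial: "hump_partial a k n = (\<Sum>j<k. s j * (1 / 3) ^ j * a n j)" for k n
    by (induction k) (simp_all add: s_def)
  show ?thesis
  proof (rule that[OF s])
    fix k
    let ?t = "\<lambda>j. s j * (1 / 3) ^ j * a k j"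
    have S: "0 \<le> S k" using bound[of k k] by linarith
    have t: "\<bar>?t j\<bar> \<le> S k * (1 / 3) ^ j" for j
      using bound[of k j] by (simp add: abs_mult s mult.commute mult_right_mono)
    have geo: "summable (\<lambda>j. S k * (1 / 3) ^ j)"
      by (intro summable_mult summable_geometric) simp
    have sum: "summable ?t"
      by (rule summable_comparison_test'[OF geo]) (use t in simp)
    have "\<bar>hump_partial a k k + ?t k\<bar> = \<bar>hump_partial a k k\<bar> + \<bar>?t k\<bar>"
    proof -
      have "0 \<le> (1 / 3) ^ k * \<bar>hump_partial a k k * a k k\<bar>" by simp
      also have "\<dots> = hump_partial a k k * ?t k" by (simp add: s_def abs_if)
      finally have "0 \<le> hump_partial a k k * ?t k" .
      then show ?thesis by (rule abs_add_eq_of_same_sign)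
    qed
    then have "\<bar>\<Sum>j<Suc k. ?t j\<bar> = \<bar>hump_partial a k k\<bar> + \<bar>?t k\<bar>"
      by (simp add: partial)
    moreover have "\<bar>?t k\<bar> = (1 / 3) ^ k * \<bar>a k k\<bar>" by (simp add: abs_mult s)
    moreover have "(1 / 3) ^ k * (2 / 3 * S k) \<le> (1 / 3) ^ k * \<bar>a k k\<bar>"
      by (intro mult_left_mono large) simp
    ultimately have head: "(1 / 3) ^ k * (2 / 3 * S k) \<le> \<bar>\<Sum>j<Suc k. ?t j\<bar>" by linarith
    have geo_tail: "(\<lambda>j. S k * (1 / 3) ^ (j + Suc k)) sums (S k * (1 / 3) ^ k / 2)"
      using sums_mult[OF geometric_sums[of "1 / 3 :: real"], of "S k * (1 / 3) ^ Suc k"]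
      by (simp add: power_add mult_ac)
    have tail_abs: "summable (\<lambda>j. \<bar>?t (j + Suc k)\<bar>)"
      by (rule summable_comparison_test'[OF sums_summable[OF geo_tail]])
        (simp only: real_norm_def abs_idempotent t)
    have "\<bar>\<Sum>j. ?t (j + Suc k)\<bar> \<le> (\<Sum>j. \<bar>?t (j + Suc k)\<bar>)"
      by (rule summable_rabs[OF tail_abs])
    also have "\<dots> \<le> (\<Sum>j. S k * (1 / 3) ^ (j + Suc k))"
      by (intro suminf_le t tail_abs sums_summable[OF geo_tail])
    also have "\<dots> = S k * (1 / 3) ^ k / 2"
      using geo_tail by (rule sums_unique[symmetric])
    finally have "\<bar>\<Sum>j. ?t (j + Suc k)\<bar> \<le> S k * (1 / 3) ^ k / 2" .
    moreover have "(\<Sum>j. ?t j) = (\<Sum>j. ?t (j + Suc k)) + (\<Sum>j<Suc k. ?t j)"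
      by (rule suminf_split_initial_segment[OF sum])
    \<comment> \<open>In units of \<open>(1 / 3) ^ k * S k\<close>, the head is at least 2/3 and the
      tail 1/3 + 1/9 + ... is at most 1/2, which leaves 1/6.\<close>
    ultimately have "(1 / 3) ^ k * (2 / 3 * S k) - S k * (1 / 3) ^ k / 2 \<le> \<bar>\<Sum>j. ?t j\<bar>"
      using head by linarith
    then show "(1 / 3) ^ k * S k / 6 \<le> \<bar>\<Sum>j. ?t j\<bar>" by (simp add: field_simps)
  qed
qed

lemma eventually_along_set:
  "eventually P (inf sequentially (principal N)) \<longleftrightarrow> (\<exists>n0. \<forall>n\<ge>n0. n \<in> N \<longrightarrow> P n)"
  by (simp add: eventually_inf_principal eventually_sequentially)

text \<open>For one fixed function the bound does not depend on the centre, so the supremum over the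
  centres is finite.\<close>

lemma abs_distr_pairing_bump_le:
  assumes "open D" "locally_integrable_on D w" "0 \<le> \<rho>" "cball z \<rho> \<subseteq> K" "compact K" "K \<subseteq> D"
  shows "\<bar>distr_pairing D w (bump \<rho> z)\<bar> \<le> (LINT x|lebesgue_on K. \<bar>real_of_ereal (w x)\<bar>)"
proof -
  have "distr_pairing D w (bump \<rho> z) = (LINT x|lebesgue_on K. bump \<rho> z x * real_of_ereal (w x))"
    using assms by (intro distr_pairing_eq bump_eq_0_outside) auto
  also have "\<bar>\<dots>\<bar> \<le> (LINT x|lebesgue_on K. \<bar>bump \<rho> z x * real_of_ereal (w x)\<bar>)"
    by (rule integral_abs_bound)
  also have "\<dots> \<le> (LINT x|lebesgue_on K. \<bar>real_of_ereal (w x)\<bar>)"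
    using integrable_mult_locally_integrable[OF assms(2,5,6) continuous_on_bump]
      locally_integrable_on_integrable[OF assms(2,5,6)]
    by (intro integral_mono integrable_abs)
      (auto simp: abs_mult bump_nonneg bump_le_1 simp del: abs_real_of_ereal intro!: mult_left_le_one_le)
  finally show ?thesis .
qed

lemma distr_pairing_bump_series:
  assumes "open D" "locally_integrable_on D w" "0 \<le> \<rho>" "compact K" "K \<subseteq> D"
    and z: "\<And>j. cball (z j) \<rho> \<subseteq> K" and c: "summable (\<lambda>j. \<bar>c j\<bar>)"
  shows "distr_pairing D w (\<lambda>x. \<Sum>j. c j * bump \<rho> (z j) x) = (\<Sum>j. c j * distr_pairing D w (bump \<rho> (z j)))"
proof -
  let ?W = "\<lambda>x. real_of_ereal (w x)"
  have zero: "bump \<rho> (z j) x = 0" if "x \<notin> K" for j x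
    using assms(3) z that by (rule bump_eq_0_outside)
  have c_bump: "\<bar>c j * bump \<rho> (z j) x\<bar> \<le> \<bar>c j\<bar>" for j x
    by (simp add: abs_mult bump_nonneg bump_le_1 mult_left_le)
  have sum: "summable (\<lambda>j. \<bar>c j * bump \<rho> (z j) x\<bar>)" for x
    by (rule summable_comparison_test'[OF c]) (use c_bump in simp)
  note int = integrable_mult_locally_integrable[OF assms(2,4,5) continuous_on_bump]
  have "distr_pairing D w (\<lambda>x. \<Sum>j. c j * bump \<rho> (z j) x)
      = (LINT x|lebesgue_on K. (\<Sum>j. c j * bump \<rho> (z j) x) * ?W x)"
    using assms zero by (intro distr_pairing_eq) auto
  also have "\<dots> = (LINT x|lebesgue_on K. (\<Sum>j. c j * bump \<rho> (z j) x * ?W x))"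
    using summable_rabs_cancel[OF sum] by (simp add: suminf_mult2)
  also have "\<dots> = (\<Sum>j. LINT x|lebesgue_on K. c j * bump \<rho> (z j) x * ?W x)"
  proof (rule integral_suminf)
    show "integrable (lebesgue_on K) (\<lambda>x. c j * bump \<rho> (z j) x * ?W x)" for j
      unfolding mult.assoc by (intro integrable_mult_right int)
    show "AE x in lebesgue_on K. summable (\<lambda>j. norm (c j * bump \<rho> (z j) x * ?W x))"
      using summable_mult2[OF sum] by (auto simp: abs_mult intro!: AE_I2)
    show "summable (\<lambda>j. LINT x|lebesgue_on K. norm (c j * bump \<rho> (z j) x * ?W x))"
    proof (rule summable_comparison_test'[OF summable_mult2[OF c]])
      fix j
      have "(LINT x|lebesgue_on K. norm (c j * bump \<rho> (z j) x * ?W x))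
          \<le> (LINT x|lebesgue_on K. \<bar>c j\<bar> * \<bar>?W x\<bar>)"
      proof (rule integral_mono)
        show "integrable (lebesgue_on K) (\<lambda>x. norm (c j * bump \<rho> (z j) x * ?W x))"
          unfolding mult.assoc by (intro integrable_norm integrable_mult_right int)
        show "integrable (lebesgue_on K) (\<lambda>x. \<bar>c j\<bar> * \<bar>?W x\<bar>)"
          by (intro integrable_mult_right integrable_abs locally_integrable_on_integrable[OF assms(2,4,5)])
        show "norm (c j * bump \<rho> (z j) x * ?W x) \<le> \<bar>c j\<bar> * \<bar>?W x\<bar>" for x
          using mult_right_mono[OF c_bump[of j x], of "\<bar>?W x\<bar>"]
          by (simp add: abs_mult del: abs_real_of_ereal)
      qed
      also have "\<dots> = \<bar>c j\<bar> * (LINT x|lebesgue_on K. \<bar>?W x\<bar>)" by simp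
      finally show "norm (LINT x|lebesgue_on K. norm (c j * bump \<rho> (z j) x * ?W x))
          \<le> \<bar>c j\<bar> * (LINT x|lebesgue_on K. \<bar>?W x\<bar>)"
        by simp
    qed
  qed
  also have "\<dots> = (\<Sum>j. c j * distr_pairing D w (bump \<rho> (z j)))"
  proof (intro suminf_cong)
    fix j
    have "distr_pairing D w (bump \<rho> (z j)) = (LINT x|lebesgue_on K. bump \<rho> (z j) x * ?W x)"
      using assms zero by (intro distr_pairing_eq) auto
    then show "(LINT x|lebesgue_on K. c j * bump \<rho> (z j) x * ?W x) = c j * distr_pairing D w (bump \<rho> (z j))"
      by (simp add: mult.assoc)
  qed
  finally show ?thesis .
qed

lemma test_function_bump_series:
  assumes "0 \<le> \<rho>" "compact K" "K \<subseteq> D"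
    and z: "\<And>j. cball (z j) \<rho> \<subseteq> K" and c: "summable (\<lambda>j. \<bar>c j\<bar>)"
  shows "test_function D (\<lambda>x. \<Sum>j. c j * bump \<rho> (z j) x)"
proof (rule test_functionI[OF _ assms(2,3)])
  show "C_k k (\<lambda>x. \<Sum>j. c j * bump \<rho> (z j) x)" for k
    unfolding bump_translate[of \<rho> "z _"]
  proof (rule C_k_translation_series[OF C_k_bump compact_cball _ c])
    show "bump \<rho> 0 x = 0" if "x \<notin> cball 0 \<rho>" for x
      using assms(1) order_refl that by (rule bump_eq_0_outside)
  qed
  show "(\<Sum>j. c j * bump \<rho> (z j) x) = 0" if "x \<notin> K" for x
  proof -
    have "bump \<rho> (z j) x = 0" for j
      using assms(1) z that by (rule bump_eq_0_outside)
    then show ?thesis by simp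
  qed
qed

text \<open>If the pairings were not uniformly bounded, one could pick indices \<open>n k\<close>
  and centres \<open>z k\<close> with rapidly growing pairings. The hump assembles the bumps at
  these centres into a single test function whose pairings along \<open>n k\<close> are unbounded,
  although they converge.\<close>

lemma tendsto_distr_bump_bounded:
  assumes D: "open D" and conv: "tendsto_distr D w u (inf sequentially (principal N))"
    and "0 \<le> R" "0 < \<rho>" and sub: "cball z0 (R + \<rho>) \<subseteq> D"
  obtains C where
    "\<forall>\<^sub>F n in inf sequentially (principal N). \<forall>z\<in>cball z0 R. \<bar>distr_pairing D (w n) (bump \<rho> z)\<bar> \<le> C"
proof -
  let ?F = "inf sequentially (principal N)"
  let ?T = "\<lambda>n z. distr_pairing D (w n) (bump \<rho> z)"
  let ?K = "cball z0 (R + \<rho>)"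
  have "\<exists>C. \<forall>\<^sub>F n in ?F. \<forall>z\<in>cball z0 R. \<bar>?T n z\<bar> \<le> C"
  proof (rule ccontr)
    assume unbounded: "\<nexists>C. \<forall>\<^sub>F n in ?F. \<forall>z\<in>cball z0 R. \<bar>?T n z\<bar> \<le> C"
    obtain n0 where n0: "\<And>n. n0 \<le> n \<Longrightarrow> n \<in> N \<Longrightarrow> locally_integrable_on D (w n)"
      using conv unfolding tendsto_distr_def eventually_along_set by blast
    \<comment> \<open>A pairing above 9 k 3^k at some centre gives one above 6 k 3^k at a centre
      that reaches 2/3 of the supremum. The supremum need not be attained, hence the factor 2/3. The
      growth 3^k compensates the coefficient 3^(-k) of the k-th hump.\<close>
    have "\<exists>n z. k \<le> n \<and> n0 \<le> n \<and> n \<in> N \<and> z \<in> cball z0 R \<and> 6 * real k * 3 ^ k < \<bar>?T n z\<bar> \<and>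
        (\<forall>z'\<in>cball z0 R. 2 / 3 * \<bar>?T n z'\<bar> \<le> \<bar>?T n z\<bar>)" for k
    proof -
      have "\<not> (\<forall>\<^sub>F n in ?F. \<forall>z\<in>cball z0 R. \<bar>?T n z\<bar> \<le> 9 * real k * 3 ^ k)"
        using unbounded by blast
      then obtain n z1 where n: "max k n0 \<le> n" "n \<in> N"
        and z1: "z1 \<in> cball z0 R" "9 * real k * 3 ^ k < \<bar>?T n z1\<bar>"
        unfolding eventually_along_set by (metis linorder_not_le)
      have li: "locally_integrable_on D (w n)" using n0 n by simp
      have ball: "cball z \<rho> \<subseteq> ?K" if "z \<in> cball z0 R" for z
        using that by (simp add: cball_subset_cball_iff dist_commute)
      define A where "A = (\<lambda>z. \<bar>?T n z\<bar>) ` cball z0 R"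
      have bdd: "bdd_above A"
        unfolding A_def bdd_above_def
        using abs_distr_pairing_bump_le[OF D li less_imp_le[OF assms(4)] ball compact_cball sub] by blast
      have z1_le: "\<bar>?T n z1\<bar> \<le> Sup A" using z1(1) bdd by (intro cSup_upper) (auto simp: A_def)
      \<comment> \<open>A positive supremum strictly exceeds 2/3 of itself; even for k = 0 it is
        positive, because the inequality for \<open>z1\<close> is strict.\<close>
      have "0 \<le> 9 * real k * 3 ^ k" by simp
      then have "0 < Sup A" using z1(2) z1_le by linarith
      then have "2 / 3 * Sup A < Sup A" by simp
      then obtain z where z: "z \<in> cball z0 R" "2 / 3 * Sup A < \<bar>?T n z\<bar>"
        using less_cSup_iff[OF _ bdd, of "2 / 3 * Sup A"] z1(1) unfolding A_def by blast
      have "2 / 3 * \<bar>?T n z'\<bar> \<le> \<bar>?T n z\<bar>" if "z' \<in> cball z0 R" for z'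
      proof -
        have "\<bar>?T n z'\<bar> \<le> Sup A" using that bdd by (intro cSup_upper) (auto simp: A_def)
        then show ?thesis using z(2) by linarith
      qed
      moreover have "6 * real k * 3 ^ k < \<bar>?T n z\<bar>"
        using z(2) z1_le z1(2) by linarith
      ultimately show ?thesis using n z(1) by (metis max.bounded_iff)
    qed
    then obtain n z where n: "\<And>k. k \<le> n k" "\<And>k. n0 \<le> n k" "\<And>k. n k \<in> N"
      and z: "\<And>k. z k \<in> cball z0 R" "\<And>k. 6 * real k * 3 ^ k < \<bar>?T (n k) (z k)\<bar>"
        "\<And>k z'. z' \<in> cball z0 R \<Longrightarrow> 2 / 3 * \<bar>?T (n k) z'\<bar> \<le> \<bar>?T (n k) (z k)\<bar>"
      by metis
    have ball: "cball (z j) \<rho> \<subseteq> ?K" for j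
      using z(1)[of j] by (simp add: cball_subset_cball_iff dist_commute)
    define S where "S k = 3 / 2 * \<bar>?T (n k) (z k)\<bar>" for k
    obtain s where s: "\<And>j. \<bar>s j\<bar> = 1"
      "\<And>k. (1 / 3) ^ k * S k / 6 \<le> \<bar>\<Sum>j. s j * (1 / 3) ^ j * ?T (n k) (z j)\<bar>"
    proof (rule gliding_hump[of "\<lambda>k j. ?T (n k) (z j)" S])
      show "\<bar>?T (n k) (z j)\<bar> \<le> S k" for k j
        using z(3)[OF z(1)[of j], of k] by (simp add: S_def)
      show "2 / 3 * S k \<le> \<bar>?T (n k) (z k)\<bar>" for k by (simp add: S_def)
    qed blast
    define c where "c j = s j * (1 / 3) ^ j" for j
    have c: "summable (\<lambda>j. \<bar>c j\<bar>)"
      by (simp add: c_def abs_mult s summable_geometric)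
    define \<Phi> where "\<Phi> x = (\<Sum>j. c j * bump \<rho> (z j) x)" for x
    have "test_function D \<Phi>"
      unfolding \<Phi>_def[abs_def] using assms(4)
      by (intro test_function_bump_series[OF _ compact_cball sub ball c]) simp
    then have "((\<lambda>n. distr_pairing D (w n) \<Phi>) \<longlongrightarrow> distr_pairing D u \<Phi>) ?F"
      using conv by (simp add: tendsto_distr_def)
    \<comment> \<open>The indices need not increase; \<open>k \<le> n k\<close> already forces them
      to infinity.\<close>
    moreover have "filterlim n ?F sequentially"
      unfolding filterlim_inf filterlim_principal
      using filterlim_at_top_mono[OF filterlim_ident, of n] n by (simp add: always_eventually)
    ultimately have "(\<lambda>k. distr_pairing D (w (n k)) \<Phi>) \<longlonglongrightarrow> distr_pairing D u \<Phi>"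
      by (rule filterlim_compose)
    then have "Bseq (\<lambda>k. distr_pairing D (w (n k)) \<Phi>)"
      by (intro convergent_imp_Bseq convergentI)
    then obtain B where B: "\<And>k. \<bar>distr_pairing D (w (n k)) \<Phi>\<bar> \<le> B"
      unfolding Bseq_def by auto
    obtain k where k: "B < real k" using reals_Archimedean2 by blast
    have "distr_pairing D (w (n k)) \<Phi> = (\<Sum>j. c j * ?T (n k) (z j))"
      unfolding \<Phi>_def[abs_def] using assms(4)
      by (intro distr_pairing_bump_series[OF D n0[OF n(2,3)] _ compact_cball sub ball c]) simp
    then have "(1 / 3) ^ k * S k / 6 \<le> B"
      using s(2)[of k] B[of k] by (simp add: c_def)
    moreover have "6 * real k \<le> (1 / 3) ^ k * S k"
    proof -
      have "6 * real k * 3 ^ k \<le> S k" using z(2)[of k] unfolding S_def by linarith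
      then have "(1 / 3) ^ k * (6 * real k * 3 ^ k) \<le> (1 / 3) ^ k * S k"
        by (intro mult_left_mono) auto
      then show ?thesis by (simp add: power_one_over)
    qed
    ultimately show False using k by simp
  qed
  then show ?thesis using that by blast
qed

section \<open>Locally uniform upper bounds\<close>

lemma flat_exp_0_mono: "s \<le> t \<Longrightarrow> flat_exp 0 s \<le> flat_exp 0 t"
  by (auto simp: flat_exp_def)

text \<open>The larger radius makes up for the displaced centre: with d = |x - a| < \<rho>, the
  arguments of \<open>flat_exp\<close> compare because (d + \<delta>)^2 falls short of (\<rho> +
  \<delta>)^2 - (\<rho>^2 - d^2) by 2 \<delta> (\<rho> - d).\<close>

lemma bump_mono:
  assumes "0 \<le> \<rho>" "dist a z \<le> \<delta>"
  shows "bump \<rho> a x \<le> bump (\<rho> + \<delta>) z x"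
proof (cases "x \<in> ball a \<rho>")
  case True
  define d where "d = norm (x - a)"
  have d: "0 \<le> d" "d < \<rho>" using True by (auto simp: d_def dist_norm norm_minus_commute)
  have \<delta>: "0 \<le> \<delta>" using assms(2) zero_le_dist order_trans by blast
  have "norm (x - z) \<le> d + \<delta>"
    using norm_triangle_ineq[of "x - a" "a - z"] assms(2) by (simp add: d_def dist_norm)
  then have "(norm (x - z))\<^sup>2 \<le> (d + \<delta>)\<^sup>2" by (intro power_mono) auto
  also have "\<dots> = (\<rho> + \<delta>)\<^sup>2 - (\<rho>\<^sup>2 - d\<^sup>2) - 2 * \<delta> * (\<rho> - d)"
    by (simp add: power2_eq_square algebra_simps)
  also have "\<dots> \<le> (\<rho> + \<delta>)\<^sup>2 - (\<rho>\<^sup>2 - d\<^sup>2)" using d \<delta> by simp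
  finally have "\<rho>\<^sup>2 - d\<^sup>2 \<le> (\<rho> + \<delta>)\<^sup>2 - (norm (x - z))\<^sup>2" by linarith
  then show ?thesis unfolding bump_def d_def by (rule flat_exp_0_mono)
qed (use assms(1) in \<open>simp add: bump_eq_0 bump_nonneg\<close>)

text \<open>Dominated convergence along radii \<rho> + d/(k+1). Exchanging a bump for a larger one
  costs a multiple of the mass gained, which this makes small.\<close>

lemma bump_mass_right_continuous:
  assumes "0 \<le> \<rho>" "0 < \<epsilon>" "0 < d"
  obtains \<delta> where "0 < \<delta>" "\<delta> \<le> d" "bump_mass (\<rho> + \<delta>) < bump_mass \<rho> + \<epsilon>"
proof -
  define \<delta> where "\<delta> k = d / real (Suc k)" for k
  have \<delta>: "0 < \<delta> k" "\<delta> k \<le> d" for k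
    using assms(3) by (auto simp: \<delta>_def divide_le_eq)
  have \<delta>_lim: "\<delta> \<longlonglongrightarrow> 0"
    unfolding \<delta>_def by (rule tendsto_divide_0[OF tendsto_const])
      (intro filterlim_at_top_imp_at_infinity filterlim_compose[OF filterlim_real_sequentially filterlim_Suc])
  have "(\<lambda>k. LINT x|lborel. bump (\<rho> + \<delta> k) 0 x) \<longlonglongrightarrow> (LINT x|lborel. bump \<rho> 0 x)"
  proof (rule integral_dominated_convergence[where w = "\<lambda>x. indicator (cball 0 (\<rho> + d)) x"])
    show "integrable lborel (indicator (cball (0::complex) (\<rho> + d)) :: complex \<Rightarrow> real)"
      using emeasure_lborel_cball_finite[of "0::complex" "\<rho> + d"] by (intro integrable_real_indicator) auto
    show "AE x :: complex in lborel. (\<lambda>k. bump (\<rho> + \<delta> k) 0 x) \<longlonglongrightarrow> bump \<rho> 0 x"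
    proof (rule AE_I2)
      fix x :: complex
      have "(\<lambda>k. (\<rho> + \<delta> k)\<^sup>2 - (norm (x - 0))\<^sup>2) \<longlonglongrightarrow> (\<rho> + 0)\<^sup>2 - (norm (x - 0))\<^sup>2"
        by (intro tendsto_intros \<delta>_lim)
      then show "(\<lambda>k. bump (\<rho> + \<delta> k) 0 x) \<longlonglongrightarrow> bump \<rho> 0 x"
        unfolding bump_def
        using isCont_tendsto_compose[OF DERIV_isCont[OF DERIV_flat_exp], of _ "\<rho>\<^sup>2 - (norm (x - 0))\<^sup>2"] by simp
    qed
    show "AE x :: complex in lborel. norm (bump (\<rho> + \<delta> k) 0 x) \<le> indicator (cball 0 (\<rho> + d)) x" for k
    proof (rule AE_I2)
      fix x :: complex
      have "bump (\<rho> + \<delta> k) 0 x = 0" if "x \<notin> cball 0 (\<rho> + d)"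
        using assms(1) \<delta>[of k] that by (intro bump_eq_0_outside[of _ _ "cball 0 (\<rho> + d)"]) auto
      then show "norm (bump (\<rho> + \<delta> k) 0 x) \<le> indicator (cball 0 (\<rho> + d)) x"
        by (auto simp: bump_nonneg bump_le_1 split: split_indicator)
    qed
  qed auto
  then have "(\<lambda>k. bump_mass (\<rho> + \<delta> k)) \<longlonglongrightarrow> bump_mass \<rho>"
    by (simp add: bump_mass_def)
  then have "\<forall>\<^sub>F k in sequentially. bump_mass (\<rho> + \<delta> k) < bump_mass \<rho> + \<epsilon>"
    using assms(2) by (intro order_tendstoD) auto
  then obtain k where "bump_mass (\<rho> + \<delta> k) < bump_mass \<rho> + \<epsilon>"
    by (auto simp: eventually_sequentially)
  with \<delta> show ?thesis by (rule that)
qed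

lemma distr_pairing_bump_compare:
  assumes "open D" "locally_integrable_on D w" "0 \<le> \<rho>" "dist a z \<le> \<delta>"
    and K: "compact K" "K \<subseteq> D" "cball a \<rho> \<subseteq> K" "cball z (\<rho> + \<delta>) \<subseteq> K"
    and "\<And>x. x \<in> K \<Longrightarrow> w x \<le> ereal M"
  shows "distr_pairing D w (bump (\<rho> + \<delta>) z)
    \<le> M * (bump_mass (\<rho> + \<delta>) - bump_mass \<rho>) + distr_pairing D w (bump \<rho> a)"
proof -
  have \<delta>: "0 \<le> \<rho> + \<delta>" using assms(3,4) zero_le_dist[of a z] by linarith
  have K_sets: "K \<in> sets lebesgue" using K(1) by (simp add: compact_imp_closed)
  note int = integrable_mult_locally_integrable[OF assms(2) K(1,2) continuous_on_bump]
  have intM: "integrable (lebesgue_on K) (\<lambda>x. bump \<rho>' z' x * M)" if "0 \<le> \<rho>'" for \<rho>' z'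
    by (intro integrable_mult_left integrable_lebesgue_on_bump that K_sets)
  let ?b = "bump \<rho> a" and ?b' = "bump (\<rho> + \<delta>) z" and ?W = "\<lambda>x. real_of_ereal (w x)"
  have "distr_pairing D w ?b' - distr_pairing D w ?b = (LINT x|lebesgue_on K. ?b' x * ?W x - ?b x * ?W x)"
    using assms(3) \<delta> K(3,4) bump_eq_0_outside
    by (subst Bochner_Integration.integral_diff[OF int int])
      (simp add: distr_pairing_eq[OF assms(1) K(1,2)])
  also have "\<dots> \<le> (LINT x|lebesgue_on K. ?b' x * M - ?b x * M)"
  proof (rule integral_mono_AE)
    show "AE x in lebesgue_on K. ?b' x * ?W x - ?b x * ?W x \<le> ?b' x * M - ?b x * M"
      using locally_integrable_on_AE_finite[OF assms(2) K(1,2)] AE_space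
    proof eventually_elim
      case (elim x)
      then have "w x \<le> ereal M" using assms(9) by simp
      with elim have "?W x \<le> M" by (cases "w x") auto
      then have "(?b' x - ?b x) * ?W x \<le> (?b' x - ?b x) * M"
        using bump_mono[OF assms(3,4), of x] by (intro mult_left_mono) auto
      then show ?case by (simp add: left_diff_distrib)
    qed
  qed (intro Bochner_Integration.integrable_diff int intM assms(3) \<delta>)+
  also have "\<dots> = bump_mass (\<rho> + \<delta>) * M - bump_mass \<rho> * M"
    using bump_mass_eq[OF \<delta> K_sets K(4)] bump_mass_eq[OF assms(3) K_sets K(3)]
    by (subst Bochner_Integration.integral_diff[OF intM[OF \<delta>] intM[OF assms(3)]]) simp
  finally show ?thesis by (simp add: algebra_simps)
qed

lemma distr_pairing_bump_ge:
  assumes "open D" "locally_integrable_on D w" "0 \<le> \<rho>" "cball z \<rho> \<subseteq> D"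
    and "\<And>x. x \<in> cball z \<rho> \<Longrightarrow> ereal c \<le> w x"
  shows "c * bump_mass \<rho> \<le> distr_pairing D w (bump \<rho> z)"
proof -
  have "locally_integrable_on D (\<lambda>x. - w x)"
    using assms(2) by (auto simp: locally_integrable_on_def)
  moreover have "- w x \<le> ereal (- c)" if "x \<in> cball z \<rho>" for x
    using assms(5)[OF that] by (simp add: ereal_minus_le_minus flip: uminus_ereal.simps)
  ultimately have "distr_pairing D (\<lambda>x. - w x) (bump \<rho> z) \<le> - c * bump_mass \<rho>"
    using assms(1,3,4) by (intro distr_pairing_bump_le) auto
  then show ?thesis by (simp add: distr_pairing_def)
qed

text \<open>Once \<open>w n \<le> M\<close>, the bump of radius \<open>\<rho> + \<delta>\<close> at any \<open>z\<close> near \<open>z0\<close> may be replaced by the fixed bump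
  of radius \<open>\<rho>\<close> at \<open>z0\<close>, because it dominates the latter and \<open>M - w n \<ge> 0\<close>; this makes the bound
  uniform in \<open>z\<close>.\<close>

lemma tendsto_distr_log_abs_upper_bound:
  assumes D: "open D" and N: "\<forall>n\<in>N. n > 0" and hol: "\<And>n. n \<in> N \<Longrightarrow> f n holomorphic_on D"
    and usc: "usc_on D u"
    and conv: "tendsto_distr D (\<lambda>n z. ereal (1 / real n) * log_abs (f n z)) u (inf sequentially (principal N))"
    and z0: "z0 \<in> D" "u z0 < ereal c"
  obtains \<delta> where "0 < \<delta>" "cball z0 \<delta> \<subseteq> D"
    "\<forall>\<^sub>F n in inf sequentially (principal N). \<forall>z\<in>cball z0 \<delta>. cmod (f n z) \<le> exp (c * real n)"
proof -
  let ?F = "inf sequentially (principal N)"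
  define w where "w n z = ereal (1 / real n) * log_abs (f n z)" for n z
  have conv': "tendsto_distr D w u ?F" using conv by (simp add: w_def[abs_def])
  have w_le: "w n z \<le> ereal b \<longleftrightarrow> cmod (f n z) \<le> exp (b * real n)" if "n \<in> N" for n z b
    using scaled_log_abs_le_iff[of "1 / real n" "f n z" b] N that by (auto simp: w_def)
  have in_N: "\<forall>\<^sub>F n in ?F. n \<in> N" by (auto simp: eventually_along_set)
  have li: "\<forall>\<^sub>F n in ?F. locally_integrable_on D (w n)" and li_u: "locally_integrable_on D u"
    using conv' by (auto simp: tendsto_distr_def)
  have submean: "w n z * ereal (bump_mass \<rho>) \<le> ereal (distr_pairing D (w n) (bump \<rho> z))"
    if "n \<in> N" "locally_integrable_on D (w n)" "0 < \<rho>" "cball z \<rho> \<subseteq> D" for n z \<rho>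
    using that N by (intro log_abs_submean_bump[of D "f n" "1 / real n"] D hol) (auto simp: w_def[abs_def])
  \<comment> \<open>Three levels: u stays below c1 near \<open>z0\<close>, hence its pairing is
    below c2 times the mass; eventually so are the pairings of \<open>w n\<close>; the gap from c2
    to c pays for moving the centre.\<close>
  obtain c1 where c1: "u z0 < ereal c1" "c1 < c"
    using ereal_dense2[OF z0(2)] by auto
  obtain c2 where c2: "c1 < c2" "c2 < c" using dense[OF c1(2)] by blast
  have "open {z \<in> D. u z < ereal c1}" by (rule open_usc_less[OF D usc])
  then obtain r where r: "0 < r" "cball z0 r \<subseteq> {z \<in> D. u z < ereal c1}"
    using z0(1) c1(1) open_contains_cball by (metis (mono_tags, lifting) mem_Collect_eq)
  have sub: "cball z0 r \<subseteq> D" using r by auto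
  obtain C where C: "\<forall>\<^sub>F n in ?F. \<forall>z\<in>cball z0 (r / 2). \<bar>distr_pairing D (w n) (bump (r / 2) z)\<bar> \<le> C"
    using tendsto_distr_bump_bounded[OF D conv', of "r / 2" "r / 2" z0] r sub by auto
  define M where "M = C / bump_mass (r / 2)"
  have mass: "0 < bump_mass \<rho>" if "0 < \<rho>" for \<rho> using that by (rule bump_mass_pos)
  have M: "\<forall>\<^sub>F n in ?F. \<forall>z\<in>cball z0 (r / 2). w n z \<le> ereal M"
    using C li in_N
  proof eventually_elim
    case (elim n)
    show ?case
    proof
      fix z assume z: "z \<in> cball z0 (r / 2)"
      then have "cball z (r / 2) \<subseteq> cball z0 r"
        by (simp add: cball_subset_cball_iff dist_commute)
      then have "w n z * ereal (bump_mass (r / 2)) \<le> ereal (distr_pairing D (w n) (bump (r / 2) z))"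
        using elim r sub by (intro submean) auto
      also have "\<dots> \<le> ereal C" using elim(1) z by (auto dest!: bspec[of _ _ z])
      finally show "w n z \<le> ereal M"
        using mass[of "r / 2"] r by (cases "w n z") (auto simp: M_def pos_le_divide_eq)
    qed
  qed
  \<comment> \<open>With this radius and \<delta> <= r / 8, a disc of radius \<rho> + \<delta> about
    a point of \<open>cball z0 \<delta>\<close> stays in \<open>cball z0 (r / 2)\<close>, where
    \<open>w n\<close> is at most \<open>M\<close>.\<close>
  define \<rho> where "\<rho> = r / 4"
  have \<rho>: "0 < \<rho>" using r by (simp add: \<rho>_def)
  \<comment> \<open>Chosen so that |M - c| times the mass gained is at most (c - c2) times the mass;
    the 1 keeps the denominator positive.\<close>
  define \<epsilon> where "\<epsilon> = (c - c2) * bump_mass \<rho> / (\<bar>M - c\<bar> + 1)"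
  have "0 < \<epsilon>" using c2 mass[OF \<rho>] by (simp add: \<epsilon>_def)
  then obtain \<delta> where \<delta>: "0 < \<delta>" "\<delta> \<le> r / 8" "bump_mass (\<rho> + \<delta>) < bump_mass \<rho> + \<epsilon>"
    using bump_mass_right_continuous[of \<rho> \<epsilon> "r / 8"] \<rho> r by auto
  have sub0: "cball z0 \<rho> \<subseteq> cball z0 (r / 2)" using r by (simp add: \<rho>_def cball_subset_cball_iff)
  have mass_mono: "bump_mass \<rho> \<le> bump_mass (\<rho> + \<delta>)"
    unfolding bump_mass_def using \<rho> \<delta>
    by (intro integral_mono integrable_bump bump_mono) auto
  have "\<bar>M - c\<bar> * (bump_mass (\<rho> + \<delta>) - bump_mass \<rho>) \<le> (\<bar>M - c\<bar> + 1) * \<epsilon>"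
    using \<delta>(3) mass_mono by (intro mult_mono) auto
  also have "\<dots> = (c - c2) * bump_mass \<rho>" by (simp add: \<epsilon>_def)
  finally have key: "\<bar>M - c\<bar> * (bump_mass (\<rho> + \<delta>) - bump_mass \<rho>) \<le> (c - c2) * bump_mass \<rho>" .
  have "(M - c) * (bump_mass (\<rho> + \<delta>) - bump_mass \<rho>) \<le> \<bar>M - c\<bar> * (bump_mass (\<rho> + \<delta>) - bump_mass \<rho>)"
    using mass_mono by (intro mult_right_mono) auto
  with key have key': "M * (bump_mass (\<rho> + \<delta>) - bump_mass \<rho>) + c2 * bump_mass \<rho> \<le> c * bump_mass (\<rho> + \<delta>)"
    by (simp add: algebra_simps)
  have "distr_pairing D u (bump \<rho> z0) \<le> c1 * bump_mass \<rho>"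
  proof (rule distr_pairing_bump_le[OF D li_u])
    have le: "cball z0 \<rho> \<subseteq> cball z0 r" using r by (auto simp: \<rho>_def)
    then show "cball z0 \<rho> \<subseteq> D" using sub by blast
    show "u x \<le> ereal c1" if "x \<in> cball z0 \<rho>" for x
      using subsetD[OF r(2) subsetD[OF le that]] by (auto intro: less_imp_le)
  qed (use \<rho> in simp)
  also have "\<dots> < c2 * bump_mass \<rho>" using c2 mass[OF \<rho>] by simp
  finally have "distr_pairing D u (bump \<rho> z0) < c2 * bump_mass \<rho>" .
  moreover have "((\<lambda>n. distr_pairing D (w n) (bump \<rho> z0)) \<longlongrightarrow> distr_pairing D u (bump \<rho> z0)) ?F"
  proof -
    have "cball z0 \<rho> \<subseteq> D" using sub r by (auto simp: \<rho>_def subset_iff)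
    then show ?thesis
      using conv' test_function_bump[OF less_imp_le[OF \<rho>]] by (simp add: tendsto_distr_def)
  qed
  ultimately have "\<forall>\<^sub>F n in ?F. distr_pairing D (w n) (bump \<rho> z0) < c2 * bump_mass \<rho>"
    by (rule order_tendstoD(2)[rotated])
  then have "\<forall>\<^sub>F n in ?F. \<forall>z\<in>cball z0 \<delta>. cmod (f n z) \<le> exp (c * real n)"
    using M li in_N
  proof eventually_elim
    case (elim n)
    show ?case
    proof
      fix z assume z: "z \<in> cball z0 \<delta>"
      then have "dist z0 z + (\<rho> + \<delta>) \<le> r / 2" using \<delta>(2) r by (simp add: \<rho>_def)
      then have sub1: "cball z (\<rho> + \<delta>) \<subseteq> cball z0 (r / 2)"
        by (simp add: cball_subset_cball_iff dist_commute)
      have sub2: "cball z0 (r / 2) \<subseteq> D" using r sub by (auto simp: subset_iff)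
      have "distr_pairing D (w n) (bump (\<rho> + \<delta>) z)
          \<le> M * (bump_mass (\<rho> + \<delta>) - bump_mass \<rho>) + distr_pairing D (w n) (bump \<rho> z0)"
        using elim z \<rho> by (intro distr_pairing_bump_compare[OF D _ _ _ compact_cball sub2 sub0 sub1]) auto
      also have "\<dots> \<le> c * bump_mass (\<rho> + \<delta>)" using elim(1) key' by linarith
      finally have "distr_pairing D (w n) (bump (\<rho> + \<delta>) z) \<le> c * bump_mass (\<rho> + \<delta>)" .
      moreover have "w n z * ereal (bump_mass (\<rho> + \<delta>)) \<le> ereal (distr_pairing D (w n) (bump (\<rho> + \<delta>) z))"
        using elim sub1 sub2 \<rho> \<delta>(1) by (intro submean) auto
      ultimately have "w n z * ereal (bump_mass (\<rho> + \<delta>)) \<le> ereal (c * bump_mass (\<rho> + \<delta>))"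
        by (meson ereal_less_eq(3) order_trans)
      then have "w n z \<le> ereal c"
        using mass[of "\<rho> + \<delta>"] \<rho> \<delta>(1) by (cases "w n z") auto
      then show "cmod (f n z) \<le> exp (c * real n)" using elim w_le by simp
    qed
  qed
  moreover have "cball z0 \<delta> \<subseteq> D" using \<delta>(2) r sub by (auto simp: subset_iff)
  ultimately show ?thesis using \<delta>(1) that by blast
qed

section \<open>Limits and derivatives\<close>

lemma distr_limit_le_of_upper_bound:
  assumes D: "open D" and N: "infinite N"
    and conv: "tendsto_distr D w u (inf sequentially (principal N))"
    and "0 \<le> \<rho>" "cball z \<rho> \<subseteq> D"
    and le: "\<forall>\<^sub>F n in inf sequentially (principal N). \<forall>x\<in>cball z \<rho>. w n x \<le> ereal c"
  shows "distr_pairing D u (bump \<rho> z) \<le> c * bump_mass \<rho>"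
proof (rule tendsto_upperbound)
  let ?F = "inf sequentially (principal N)"
  show "((\<lambda>n. distr_pairing D (w n) (bump \<rho> z)) \<longlongrightarrow> distr_pairing D u (bump \<rho> z)) ?F"
    using conv test_function_bump[OF assms(4,5)] by (simp add: tendsto_distr_def)
  have "\<forall>\<^sub>F n in ?F. locally_integrable_on D (w n)"
    using conv by (simp add: tendsto_distr_def)
  with le show "\<forall>\<^sub>F n in ?F. distr_pairing D (w n) (bump \<rho> z) \<le> c * bump_mass \<rho>"
    by eventually_elim (use assms(4,5) in \<open>intro distr_pairing_bump_le[OF D]; simp\<close>)
  show "?F \<noteq> bot"
    using N unfolding trivial_limit_def eventually_along_set
    by (metis infinite_nat_iff_unbounded_le)
qed

text \<open>The bound passes to the limits of the pairings, and the submean inequality brings it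
  back to the value at \<open>z\<close> itself, where a bound almost everywhere would say
  nothing.\<close>

lemma subharmonic_on_le_of_upper_bound:
  assumes D: "open D" and N: "infinite N" and u: "subharmonic_on D u"
    and conv: "tendsto_distr D w u (inf sequentially (principal N))"
    and z: "0 < \<delta>" "cball z \<delta> \<subseteq> D"
    and le: "\<forall>\<^sub>F n in inf sequentially (principal N). \<forall>x\<in>cball z \<delta>. w n x \<le> ereal c"
  shows "u z \<le> ereal c"
proof -
  have "z \<in> D" using z by (metis centre_in_cball less_imp_le subsetD)
  moreover have "locally_integrable_on D u" using conv by (simp add: tendsto_distr_def)
  ultimately obtain \<rho>0 where \<rho>0: "0 < \<rho>0" "\<And>\<rho>. 0 < \<rho> \<and> \<rho> \<le> \<rho>0 \<Longrightarrow>
      cball z \<rho> \<subseteq> D \<and> u z * ereal (bump_mass \<rho>) \<le> ereal (distr_pairing D u (bump \<rho> z))"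
    using subharmonic_on_submean_bump[OF D u] by blast
  define \<rho> where "\<rho> = min \<rho>0 \<delta>"
  have \<rho>: "0 < \<rho>" "\<rho> \<le> \<rho>0" "\<rho> \<le> \<delta>" using \<rho>0(1) z(1) by (auto simp: \<rho>_def)
  have "u z * ereal (bump_mass \<rho>) \<le> ereal (distr_pairing D u (bump \<rho> z))"
    using \<rho>0(2)[of \<rho>] \<rho> by simp
  also have "distr_pairing D u (bump \<rho> z) \<le> c * bump_mass \<rho>"
  proof (rule distr_limit_le_of_upper_bound[OF D N conv])
    show "cball z \<rho> \<subseteq> D" using \<rho>0(2) \<rho> by blast
    show "\<forall>\<^sub>F n in inf sequentially (principal N). \<forall>x\<in>cball z \<rho>. w n x \<le> ereal c"
      using le by eventually_elim (use \<rho>(3) in auto)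
  qed (use \<rho> in simp)
  finally have "u z * ereal (bump_mass \<rho>) \<le> ereal (c * bump_mass \<rho>)" by simp
  then show ?thesis
    using bump_mass_pos[OF \<rho>(1)] by (cases "u z") auto
qed

lemma eventually_linear_ge:
  fixes a b :: real
  assumes "0 < a"
  shows "\<forall>\<^sub>F n in inf sequentially (principal N). b \<le> a * real n"
proof -
  obtain n0 where n0: "b / a \<le> real n0" using real_arch_simple by blast
  have "b \<le> a * real n" if "n0 \<le> n" for n
  proof -
    have "b / a \<le> real n" using n0 that by linarith
    then show ?thesis using assms by (simp add: pos_divide_le_eq mult.commute)
  qed
  then show ?thesis unfolding eventually_along_set by blast
qed

text \<open>The submean inequality on a small bump gives u z <= A. If u z < b < A, then u < b on a
  whole disc by upper semicontinuity, and the pairing with its bump is too small. So equality holds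
  at every point and not merely almost everywhere.\<close>

lemma constant_of_pairing_proportional:
  assumes D: "open D" and u: "subharmonic_on D u" "locally_integrable_on D u"
    and V: "open V" "V \<subseteq> D"
    and proportional: "\<And>z \<rho>. 0 < \<rho> \<Longrightarrow> cball z \<rho> \<subseteq> V \<Longrightarrow> distr_pairing D u (bump \<rho> z) = A * bump_mass \<rho>"
    and z: "z \<in> V"
  shows "u z = ereal A"
proof (rule antisym)
  obtain r where r: "0 < r" "cball z r \<subseteq> V" using V(1) z open_contains_cball by blast
  have "z \<in> D" using V z by blast
  then obtain \<rho>0 where \<rho>0: "0 < \<rho>0"
    "\<And>\<rho>. 0 < \<rho> \<and> \<rho> \<le> \<rho>0 \<Longrightarrow> u z * ereal (bump_mass \<rho>) \<le> ereal (distr_pairing D u (bump \<rho> z))"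
    using subharmonic_on_submean_bump[OF D u] by blast
  define \<rho> where "\<rho> = min \<rho>0 r"
  have \<rho>: "0 < \<rho>" "\<rho> \<le> \<rho>0" "\<rho> \<le> r" using \<rho>0(1) r(1) by (auto simp: \<rho>_def)
  have "cball z \<rho> \<subseteq> V" using r(2) \<rho>(3) by (meson subset_cball order_trans)
  then have "u z * ereal (bump_mass \<rho>) \<le> ereal (A * bump_mass \<rho>)"
    using \<rho>0(2)[OF conjI[OF \<rho>(1,2)]] proportional[OF \<rho>(1)] by simp
  then show "u z \<le> ereal A"
    using bump_mass_pos[OF \<rho>(1)] by (cases "u z") auto
  show "ereal A \<le> u z"
  proof (rule ccontr)
    assume "\<not> ereal A \<le> u z"
    then have "u z < ereal A" by simp
    then obtain b where b: "u z < ereal b" "ereal b < ereal A"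
      using ereal_dense2 by blast
    have "open ({x \<in> D. u x < ereal b} \<inter> V)"
      using u(1) V(1) by (intro open_Int open_usc_less D) (auto simp: subharmonic_on_def)
    then obtain s where s: "0 < s" "cball z s \<subseteq> {x \<in> D. u x < ereal b} \<inter> V"
      using b(1) z \<open>z \<in> D\<close> open_contains_cball by (metis (mono_tags, lifting) IntI mem_Collect_eq)
    have "distr_pairing D u (bump s z) \<le> b * bump_mass s"
      using s by (intro distr_pairing_bump_le[OF D u(2)]) (auto intro: less_imp_le)
    moreover have "distr_pairing D u (bump s z) = A * bump_mass s"
      using s by (intro proportional) auto
    moreover have "b * bump_mass s < A * bump_mass s"
      using b(2) bump_mass_pos[OF s(1)] by simp
    ultimately show False by simp
  qed
qed

lemma cmod_deriv_le:
  assumes "f holomorphic_on D" "cball z0 \<delta> \<subseteq> D" "0 < \<delta>"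
    and B: "\<And>x. x \<in> cball z0 \<delta> \<Longrightarrow> cmod (f x) \<le> B" and z: "z \<in> cball z0 (\<delta> / 2)"
  shows "cmod (deriv f z) \<le> 2 / \<delta> * B"
proof -
  have sub: "cball z (\<delta> / 2) \<subseteq> cball z0 \<delta>"
    using z by (simp add: cball_subset_cball_iff dist_commute)
  have hol: "f holomorphic_on cball z (\<delta> / 2)"
    using assms(1,2) sub holomorphic_on_subset by blast
  have "cmod ((deriv ^^ 1) f z) \<le> fact 1 * B / (\<delta> / 2) ^ 1"
  proof (rule Cauchy_inequality)
    show "f holomorphic_on ball z (\<delta> / 2)" using hol holomorphic_on_subset ball_subset_cball by blast
    show "continuous_on (cball z (\<delta> / 2)) f" by (rule holomorphic_on_imp_continuous_on[OF hol])
    show "cmod (f x) \<le> B" if "cmod (z - x) = \<delta> / 2" for x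
      using sub that by (intro B) (auto simp: dist_norm subset_iff)
  qed (use assms(3) in simp)
  then show ?thesis by (simp add: mult.commute)
qed

theorem theorem2:
  fixes D :: "complex set" and N :: "nat set"
    and f :: "nat \<Rightarrow> complex \<Rightarrow> complex" and u v :: "complex \<Rightarrow> ereal"
  assumes "region D"
    and "infinite N" and "\<forall>n\<in>N. n > 0"
    and "\<forall>n\<in>N. f n analytic_on D"
    and "subharmonic_on D u" and "\<exists>z\<in>D. u z \<noteq> -\<infinity>"
    and "subharmonic_on D v" and "\<exists>z\<in>D. v z \<noteq> -\<infinity>"
    and "tendsto_distr D (\<lambda>n z. ereal (1 / real n) * log_abs (f n z)) u
           (inf sequentially (principal N))"
    and "tendsto_distr D (\<lambda>n z. ereal (1 / real n) * log_abs (deriv (f n) z)) v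
           (inf sequentially (principal N))"
  shows "(\<forall>z\<in>D. v z \<le> u z) \<and>
         (\<forall>z0\<in>D. v z0 < u z0 \<longrightarrow>
            (\<exists>V. open V \<and> z0 \<in> V \<and> V \<subseteq> D \<and> u constant_on V))"
proof (intro conjI ballI impI)
  let ?F = "inf sequentially (principal N)"
  have D: "open D" using assms(1) by (simp add: region_def)
  have hol: "f n holomorphic_on D" if "n \<in> N" for n
    using assms(4) that analytic_imp_holomorphic by blast
  then have hol': "deriv (f n) holomorphic_on D" if "n \<in> N" for n
    using that D by (intro holomorphic_deriv) auto
  have usc: "usc_on D u" "usc_on D v"
    using assms(5,7) by (auto simp: subharmonic_on_def)
  have in_N: "\<forall>\<^sub>F n in ?F. n \<in> N" by (auto simp: eventually_along_set)
  have scaled_le: "ereal (1 / real n) * log_abs x \<le> ereal b \<longleftrightarrow> cmod x \<le> exp (b * real n)"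
    if "n \<in> N" for n x b
    using scaled_log_abs_le_iff[of "1 / real n" x b] assms(3) that by auto
  have F: "?F \<noteq> bot"
    using assms(2) unfolding trivial_limit_def eventually_along_set
    by (metis infinite_nat_iff_unbounded_le)

  show "v z0 \<le> u z0" if z0: "z0 \<in> D" for z0
  proof (rule ccontr)
    assume "\<not> v z0 \<le> u z0"
    then have "u z0 < v z0" by simp
    then obtain c' where c': "u z0 < ereal c'" "ereal c' < v z0"
      using ereal_dense2 by blast
    \<comment> \<open>The gap from c to c' absorbs the factor 2 / \<delta> of Cauchy's estimate,
      which is eventually at most exp ((c' - c) n).\<close>
    obtain c where c: "u z0 < ereal c" "c < c'"
      using ereal_dense2[OF c'(1)] by auto
    obtain \<delta> where \<delta>: "0 < \<delta>" "cball z0 \<delta> \<subseteq> D"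
      "\<forall>\<^sub>F n in ?F. \<forall>z\<in>cball z0 \<delta>. cmod (f n z) \<le> exp (c * real n)"
      using tendsto_distr_log_abs_upper_bound[OF D assms(3) hol usc(1) assms(9) z0 c(1)] by blast
    have "v z0 \<le> ereal c'"
    proof (rule subharmonic_on_le_of_upper_bound[OF D assms(2,7,10)])
      show "0 < \<delta> / 2" "cball z0 (\<delta> / 2) \<subseteq> D" using \<delta> by (auto simp: subset_iff)
      have "\<forall>\<^sub>F n in ?F. ln (2 / \<delta>) \<le> (c' - c) * real n"
        using c(2) by (intro eventually_linear_ge) simp
      with \<delta>(3) in_N show "\<forall>\<^sub>F n in ?F. \<forall>x\<in>cball z0 (\<delta> / 2).
          ereal (1 / real n) * log_abs (deriv (f n) x) \<le> ereal c'"
      proof eventually_elim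
        case (elim n)
        have "2 / \<delta> = exp (ln (2 / \<delta>))" using \<delta>(1) by simp
        also have "\<dots> \<le> exp ((c' - c) * real n)" using elim(3) by simp
        finally have "2 / \<delta> * exp (c * real n) \<le> exp ((c' - c) * real n) * exp (c * real n)"
          by (intro mult_right_mono) auto
        also have "\<dots> = exp (c' * real n)" by (simp add: algebra_simps flip: exp_add)
        finally have "cmod (deriv (f n) x) \<le> exp (c' * real n)" if "x \<in> cball z0 (\<delta> / 2)" for x
          using cmod_deriv_le[OF hol[OF elim(2)] \<delta>(2,1) _ that, of "exp (c * real n)"] elim(1) by fastforce
        then show ?case using scaled_le[OF elim(2)] by simp
      qed
    qed
    with c'(2) show False by simp
  qed

  show "\<exists>V. open V \<and> z0 \<in> V \<and> V \<subseteq> D \<and> u constant_on V"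
    if z0: "z0 \<in> D" and less: "v z0 < u z0" for z0
  proof -
    obtain c' where c': "v z0 < ereal c'" "ereal c' < u z0"
      using ereal_dense2[OF less] by blast
    obtain c where c: "v z0 < ereal c" "c < c'"
      using ereal_dense2[OF c'(1)] by auto
    obtain \<delta> where \<delta>: "0 < \<delta>" "cball z0 \<delta> \<subseteq> D"
      "\<forall>\<^sub>F n in ?F. \<forall>z\<in>cball z0 \<delta>. cmod (deriv (f n) z) \<le> exp (c * real n)"
      using tendsto_distr_log_abs_upper_bound[OF D assms(3) hol' usc(2) assms(10) z0 c(1)] by blast
    have li_u: "locally_integrable_on D u" using assms(9) by (simp add: tendsto_distr_def)
    define w where "w n z = ereal (1 / real n) * log_abs (f n z)" for n z
    have conv: "tendsto_distr D w u ?F" using assms(9) by (simp add: w_def[abs_def])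
    obtain \<rho>0 where \<rho>0: "0 < \<rho>0"
      "\<And>\<rho>. 0 < \<rho> \<and> \<rho> \<le> \<rho>0 \<Longrightarrow> u z0 * ereal (bump_mass \<rho>) \<le> ereal (distr_pairing D u (bump \<rho> z0))"
      using subharmonic_on_submean_bump[OF D assms(5) li_u z0] by blast
    \<comment> \<open>Up to \<rho>0 the submean inequality turns c' < u z0 into a lower bound for
      the pairing; up to \<delta> the derivatives are controlled.\<close>
    define \<rho> where "\<rho> = min \<rho>0 \<delta>"
    have \<rho>: "0 < \<rho>" "\<rho> \<le> \<rho>0" "\<rho> \<le> \<delta>" using \<rho>0(1) \<delta>(1) by (auto simp: \<rho>_def)
    have sub: "cball z0 \<rho> \<subseteq> cball z0 \<delta>" using \<rho>(3) by (rule subset_cball)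
    have sub_D: "cball z0 \<rho> \<subseteq> D" using sub \<delta>(2) by blast
    have mass: "0 < bump_mass \<rho>" by (rule bump_mass_pos[OF \<rho>(1)])
    have "c' * bump_mass \<rho> < distr_pairing D u (bump \<rho> z0)"
    proof -
      have "ereal (c' * bump_mass \<rho>) < u z0 * ereal (bump_mass \<rho>)"
        using c'(2) mass by (cases "u z0") auto
      also note \<rho>0(2)[OF conjI[OF \<rho>(1,2)]]
      finally show ?thesis by simp
    qed
    moreover have "((\<lambda>n. distr_pairing D (w n) (bump \<rho> z0)) \<longlongrightarrow> distr_pairing D u (bump \<rho> z0)) ?F"
      using conv test_function_bump[OF less_imp_le[OF \<rho>(1)] sub_D] by (simp add: tendsto_distr_def)
    ultimately have lower: "\<forall>\<^sub>F n in ?F. c' * bump_mass \<rho> < distr_pairing D (w n) (bump \<rho> z0)"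
      by (rule order_tendstoD(1)[rotated])
    have li: "\<forall>\<^sub>F n in ?F. locally_integrable_on D (w n)"
      using conv by (simp add: tendsto_distr_def)
    \<comment> \<open>The candidate for the common limit. If \<open>f n z0 = 0\<close>, this is only
      a default value, but the proof of \<open>near\<close> shows that \<open>f n z0\<close> is
      eventually nonzero.\<close>
    define \<alpha> where "\<alpha> n = ln (cmod (f n z0)) / real n" for n
    \<comment> \<open>Two points of the disc are at most 2 \<rho> apart, so twice the oscillation of
      \<open>f n\<close> is at most 4 \<rho> exp (c n); the constant 8 leaves room.\<close>
    have "\<forall>\<^sub>F n in ?F. ln (8 * \<rho>) \<le> (c' - c) * real n"
      using c(2) by (intro eventually_linear_ge) simp
    with lower li \<delta>(3) in_N
    have near: "\<forall>\<^sub>F n in ?F. \<forall>z\<in>cball z0 \<rho>.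
      ereal (\<alpha> n - ln 4 / real n) \<le> w n z \<and> w n z \<le> ereal (\<alpha> n + ln 4 / real n)"
    proof eventually_elim
      case (elim n)
      have n: "0 < real n" using assms(3) elim(4) by simp
      \<comment> \<open>Otherwise \<open>w n\<close> would be at most c' on the whole disc, and its
        pairing would violate the lower bound.\<close>
      have "\<exists>p\<in>cball z0 \<rho>. exp (c' * real n) < cmod (f n p)"
      proof (rule ccontr)
        assume "\<not> (\<exists>p\<in>cball z0 \<rho>. exp (c' * real n) < cmod (f n p))"
        then have "w n z \<le> ereal c'" if "z \<in> cball z0 \<rho>" for z
          using that scaled_le[OF elim(4)] by (auto simp: w_def not_less)
        then have "distr_pairing D (w n) (bump \<rho> z0) \<le> c' * bump_mass \<rho>"
          using \<rho>(1) by (intro distr_pairing_bump_le[OF D elim(2) _ sub_D]) auto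
        then show False using elim(1) by simp
      qed
      then obtain p where p: "p \<in> cball z0 \<rho>" "exp (c' * real n) < cmod (f n p)" by blast
      have close: "2 * cmod (f n z - f n p) \<le> cmod (f n p)" if z: "z \<in> cball z0 \<rho>" for z
      proof -
        have "cmod (f n z - f n p) \<le> exp (c * real n) * cmod (z - p)"
        proof (rule field_differentiable_bound[OF convex_cball _ _ z p(1)])
          fix x assume x: "x \<in> cball z0 \<rho>"
          show "(f n has_field_derivative deriv (f n) x) (at x within cball z0 \<rho>)"
            using holomorphic_derivI[OF hol[OF elim(4)] D] x sub_D by blast
          show "cmod (deriv (f n) x) \<le> exp (c * real n)" using elim(3) x sub by blast
        qed
        also have "cmod (z - p) \<le> 2 * \<rho>"
          using z p(1) dist_triangle2[of z p z0] by (simp add: dist_norm dist_commute norm_minus_commute)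
        finally have "2 * cmod (f n z - f n p) \<le> exp (c * real n) * (4 * \<rho>)"
          by (simp add: mult_ac)
        also have "\<dots> \<le> exp (c * real n) * exp ((c' - c) * real n)"
        proof (rule mult_left_mono)
          have "4 * \<rho> \<le> exp (ln (8 * \<rho>))" using \<rho>(1) by simp
          also have "\<dots> \<le> exp ((c' - c) * real n)" using elim(5) by simp
          finally show "4 * \<rho> \<le> exp ((c' - c) * real n)" .
        qed simp
        also have "\<dots> = exp (c' * real n)" by (simp add: algebra_simps flip: exp_add)
        finally show ?thesis using p(2) by simp
      qed
      \<comment> \<open>An oscillation of at most half of |f n p| puts all values within a factor 2
        of |f n p|, hence within a factor 4 of |f n z0|. This is the origin of ln 4, which
        disappears after division by n.\<close>
      have bounds: "cmod (f n p) \<le> 2 * cmod (f n z)" "cmod (f n z) \<le> 2 * cmod (f n p)"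
        if "z \<in> cball z0 \<rho>" for z
        using close[OF that] norm_triangle_ineq2[of "f n p" "f n z"] norm_triangle_ineq2[of "f n z" "f n p"]
          norm_ge_zero[of "f n p"] by (auto simp: norm_minus_commute)
      have fp: "0 < cmod (f n p)" using p(2) exp_gt_zero less_trans by blast
      have z0_in: "z0 \<in> cball z0 \<rho>" using \<rho>(1) by simp
      have f0: "0 < cmod (f n z0)" using bounds(1)[OF z0_in] fp by linarith
      show ?case
      proof
        fix z assume z: "z \<in> cball z0 \<rho>"
        have fz: "0 < cmod (f n z)" using bounds(1)[OF z] fp by linarith
        have "cmod (f n z) \<le> 4 * cmod (f n z0)" using bounds(2)[OF z] bounds(1)[OF z0_in] by linarith
        then have "ln (cmod (f n z)) \<le> ln (4 * cmod (f n z0))"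
          using fz f0 by (subst ln_le_cancel_iff) auto
        then have le: "ln (cmod (f n z)) \<le> ln 4 + ln (cmod (f n z0))"
          using f0 by (simp add: ln_mult)
        have "cmod (f n z0) \<le> 4 * cmod (f n z)" using bounds(2)[OF z0_in] bounds(1)[OF z] by linarith
        then have "ln (cmod (f n z0)) \<le> ln (4 * cmod (f n z))"
          using fz f0 by (subst ln_le_cancel_iff) auto
        then have ge: "ln (cmod (f n z0)) \<le> ln 4 + ln (cmod (f n z))"
          using fz by (simp add: ln_mult)
        have "w n z = ereal (ln (cmod (f n z)) / real n)"
          using fz by (simp add: w_def log_abs_def)
        moreover have "\<alpha> n - ln 4 / real n \<le> ln (cmod (f n z)) / real n"
          unfolding \<alpha>_def diff_divide_distrib[symmetric] using ge n by (intro divide_right_mono) auto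
        moreover have "ln (cmod (f n z)) / real n \<le> \<alpha> n + ln 4 / real n"
          unfolding \<alpha>_def add_divide_distrib[symmetric] using le n by (intro divide_right_mono) auto
        ultimately show "ereal (\<alpha> n - ln 4 / real n) \<le> w n z \<and> w n z \<le> ereal (\<alpha> n + ln 4 / real n)"
          by simp
      qed
    qed
    have ln_n: "((\<lambda>n. ln 4 / real n) \<longlongrightarrow> 0) ?F"
      by (rule tendsto_mono[OF inf_le1]) (rule lim_const_over_n)
    \<comment> \<open>The sequence \<open>\<alpha>\<close> does not depend on the bump, but every
      bump in the disc determines its limit. Uniqueness of limits then makes all quotients of
      pairing and mass equal.\<close>
    have \<alpha>_lim: "(\<alpha> \<longlongrightarrow> distr_pairing D u (bump s z) / bump_mass s) ?F"
      if s: "0 < s" "cball z s \<subseteq> cball z0 \<rho>" for s z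
    proof -
      let ?q = "\<lambda>n. distr_pairing D (w n) (bump s z) / bump_mass s"
      have mass_s: "0 < bump_mass s" by (rule bump_mass_pos[OF s(1)])
      have s_D: "cball z s \<subseteq> D" using s(2) sub_D by blast
      have q: "(?q \<longlongrightarrow> distr_pairing D u (bump s z) / bump_mass s) ?F"
        using conv test_function_bump[OF less_imp_le[OF s(1)] s_D] mass_s
        by (intro tendsto_divide tendsto_const) (auto simp: tendsto_distr_def)
      have "((\<lambda>n. \<alpha> n - ?q n) \<longlongrightarrow> 0) ?F"
      proof (rule Lim_null_comparison[OF _ ln_n])
        show "\<forall>\<^sub>F n in ?F. norm (\<alpha> n - ?q n) \<le> ln 4 / real n"
          using near li
        proof eventually_elim
          case (elim n)
          have "distr_pairing D (w n) (bump s z) \<le> (\<alpha> n + ln 4 / real n) * bump_mass s"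
            using elim s by (intro distr_pairing_bump_le[OF D elim(2) _ s_D]) auto
          then have "?q n \<le> \<alpha> n + ln 4 / real n" using mass_s by (simp add: pos_divide_le_eq)
          moreover have "(\<alpha> n - ln 4 / real n) * bump_mass s \<le> distr_pairing D (w n) (bump s z)"
            using elim s by (intro distr_pairing_bump_ge[OF D elim(2) _ s_D]) auto
          then have "\<alpha> n - ln 4 / real n \<le> ?q n" using mass_s by (simp add: pos_le_divide_eq)
          ultimately show ?case by simp
        qed
      qed
      from tendsto_add[OF this q] show ?thesis by simp
    qed
    define A where "A = distr_pairing D u (bump \<rho> z0) / bump_mass \<rho>"
    have "u z = ereal A" if "z \<in> ball z0 \<rho>" for z
    proof (rule constant_of_pairing_proportional[OF D assms(5) li_u open_ball _ _ that])
      show "ball z0 \<rho> \<subseteq> D" using sub_D by auto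
      fix x s assume s: "0 < s" "cball x s \<subseteq> ball z0 \<rho>"
      then have "cball x s \<subseteq> cball z0 \<rho>" by auto
      then have "distr_pairing D u (bump s x) / bump_mass s = A"
        unfolding A_def using s(1) \<rho>(1) by (intro tendsto_unique[OF F \<alpha>_lim \<alpha>_lim]) auto
      then show "distr_pairing D u (bump s x) = A * bump_mass s"
        using bump_mass_pos[OF s(1)] by (simp add: field_simps)
    qed
    then have "u constant_on ball z0 \<rho>" by (auto simp: constant_on_def)
    then show ?thesis using \<rho>(1) sub_D by (intro exI[of _ "ball z0 \<rho>"]) auto
  qed
qed

end
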